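(* Let $(W,d)$ be a Hilbert complex with the compactness property, fix a level $k$, and let $l_1,\dots,l_5$ be bounded linear lower-order maps with associated operator $L$. Suppose $L:V^k\cap V^*_k\to (V^k\cap V^*_k)'$ is a bounded isomorphism, $(d^*+l_2)L^{-1}(W^k)\subset V^{k-1}$ and $(d^*+l_3^* )(L')^{-1}(W^k)\subset V^{k-1}$. With $K=(L')^{-1}$, suppose further that $(dd^*+d^*d)K$ is bounded $W^k\to W^k$ and that the operators $$dl_3^*K,\qquad (l_1^*d-l_2^*d^* )K$$ are compact $W^k\to W^k$. Let $V^j_h$ be a sequence of dense discrete subcomplexes of $V^j$ admitting $W$-bounded cochain projections. Then the Galerkin projection of the mixed system using the pair $V_h^{k-1}\times V_h^k$ is stable: there exist positive constants $h_0,C_0$ such that for every $h\in(0,h_0]$ (and every $f\in W^k$) there is a unique $(\sigma_h,u_h)\in V_h^{k-1}\times V_h^k$ satisfying $$(\sigma_h,\tau)-(u_h,d\tau)-(l_2u_h,\tau)=0\quad\forall\tau\in V_h^{k-1},$$ $$((d+l_3)\sigma_h,v)+((d+l_1)u_h,dv)+(l_4du_h,v)+(l_5u_h,v)=(f,v)\quad\forall v\in V_h^k,$$ and $\|\sigma_h\|_V+\|u_h\|_V\le C_0\|f\|$.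
   Context: A Hilbert complex $(W,d)$ is a sequence of (real) Hilbert spaces $W^k$ with closed densely defined linear operators $d=d^k:W^k\to W^{k+1}$ with closed range and $d^{k+1}\circ d^k=0$. Inner product and norm of $W$: $(\cdot,\cdot)$, $\|\cdot\|$. $V^k=D(d^k)$ with graph norm $\|v\|_V^2=\|v\|^2+\|dv\|^2$; $d^*=d^*_{k}:W^{k}\to W^{k-1}$ is the adjoint of $d^{k-1}$, with domain $V^*_k$. $V^k\cap V^*_k$ carries the norm with square $\|v\|^2+\|dv\|^2+\|d^*v\|^2$. Compactness property: $V^k\cap V^*_k$ is compactly and densely embedded in $W^k$ (for each $k$). Identifying $W^k$ with its dual, $V^k\cap V^*_k\subset W^k\subset (V^k\cap V^*_k)'$. Lower-order terms: $l_1:W^k\to W^{k+1}$, $l_2:W^k\to W^{k-1}$, $l_3:W^{k-1}\to W^k$, $l_4:W^{k+1}\to W^k$, $l_5:W^k\to W^k$ are bounded linear maps, with adjoints $l_i^*$. The operator $L$ is $$\langle Lu,v\rangle=((d^*+l_2)u,(d^*+l_3^* )v)+((d+l_1)u,dv)+(l_4du,v)+(l_5u,v),\quad u,v\in V^k\cap V^*_k,$$ and $L'$ is its dual, $\langle L'z,v\rangle=\langle Lv,z\rangle$. Saying that a composite operator such as $(dd^*+d^*d)K$ or $dl_3^*K$ is bounded or compact on $W^k$ includes that it is well defined on all of $W^k$. Discrete spaces: $V_h^j\subset V^j$ are finite-dimensional subspaces indexed by $h>0$ ($h\to0$). Dense: $\lim_{h\to0}\inf_{v\in V_h^j}\|u-v\|_V=0$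 for all $u\in V^j$. Subcomplex: $dV_h^j\subset V_h^{j+1}$. $W$-bounded cochain projections: projections $\pi_h^j:W^j\to V_h^j$ onto $V_h^j$ with $\|\pi_h^j\|_{W\to W}$ bounded uniformly in $h$ and $d\pi_h=\pi_hd$ on $V^j$. *)

theory Defs
  imports "HOL-Analysis.Analysis"
begin

text \<open>
  All Hilbert spaces \<open>W k\<close> (\<open>k :: int\<close>) of a complex are closed subspaces of one ambient real
  Hilbert space \<open>'a\<close>. This loses no generality: a given sequence of Hilbert spaces sits in its
  Hilbert direct sum, and complexes of finite or one-sided length are extended by \<open>{0}\<close>.
  An operator is given by its domain and a total function on \<open>'a\<close> whose values outside
  the domain are irrelevant.
\<close>

definition linear_map :: "'a::real_vector set \<Rightarrow> 'b::real_vector set \<Rightarrow> ('a \<Rightarrow> 'b) \<Rightarrow> bool" where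
  "linear_map X Y T \<longleftrightarrow>
     (\<forall>x\<in>X. T x \<in> Y) \<and>
     (\<forall>x\<in>X. \<forall>y\<in>X. T (x + y) = T x + T y) \<and>
     (\<forall>c. \<forall>x\<in>X. T (c *\<^sub>R x) = c *\<^sub>R T x)"

definition bounded_op :: "'a::real_normed_vector set \<Rightarrow> 'b::real_normed_vector set \<Rightarrow> ('a \<Rightarrow> 'b) \<Rightarrow> bool" where
  "bounded_op X Y T \<longleftrightarrow> linear_map X Y T \<and> (\<exists>C. \<forall>x\<in>X. norm (T x) \<le> C * norm x)"

text \<open>Compactness with respect to a norm \<open>nrm\<close> on \<open>X\<close> which may differ from the ambient one. The
  closure is taken in the ambient space, which is the closure in \<open>Y\<close> when \<open>Y\<close> is closed.\<close>

definition compact_op ::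
  "'a::real_vector set \<Rightarrow> ('a \<Rightarrow> real) \<Rightarrow> 'b::real_normed_vector set \<Rightarrow> ('a \<Rightarrow> 'b) \<Rightarrow> bool" where
  "compact_op X nrm Y T \<longleftrightarrow>
     linear_map X Y T \<and> (\<forall>S\<subseteq>X. bdd_above (nrm ` S) \<longrightarrow> compact (closure (T ` S)))"

text \<open>Adjoint of an operator \<open>T\<close> from the Hilbert space \<open>A\<close> to the Hilbert space \<open>B\<close> with
  domain \<open>D\<close> dense in \<open>A\<close>; for a bounded operator, \<open>D = A\<close>.\<close>

definition adjoint_dom :: "'a::real_inner set \<Rightarrow> 'a set \<Rightarrow> 'b::real_inner set \<Rightarrow> ('a \<Rightarrow> 'b) \<Rightarrow> 'b set" where
  "adjoint_dom A D B T = {y\<in>B. \<exists>z\<in>A. \<forall>x\<in>D. T x \<bullet> y = x \<bullet> z}"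

definition adjoint_op :: "'a::real_inner set \<Rightarrow> 'a set \<Rightarrow> ('a \<Rightarrow> 'b::real_inner) \<Rightarrow> 'b \<Rightarrow> 'a" where
  "adjoint_op A D T y = (THE z. z \<in> A \<and> (\<forall>x\<in>D. T x \<bullet> y = x \<bullet> z))"


definition hilbert_complex ::
  "(int \<Rightarrow> 'a::{real_inner,complete_space} set) \<Rightarrow> (int \<Rightarrow> 'a set) \<Rightarrow> (int \<Rightarrow> 'a \<Rightarrow> 'a) \<Rightarrow> bool" where
  "hilbert_complex W V d \<longleftrightarrow> (\<forall>k.
     subspace (W k) \<and> closed (W k) \<and>
     subspace (V k) \<and> V k \<subseteq> W k \<and> W k \<subseteq> closure (V k) \<and>
     linear_map (V k) (W (k + 1)) (d k) \<and>
     closed {(v, d k v) | v. v \<in> V k} \<and>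
     closed (d k ` V k) \<and>
     (\<forall>v\<in>V k. d k v \<in> V (k + 1) \<and> d (k + 1) (d k v) = 0))"

definition V_norm :: "(int \<Rightarrow> 'a::real_inner \<Rightarrow> 'a) \<Rightarrow> int \<Rightarrow> 'a \<Rightarrow> real" where
  "V_norm d k v = sqrt ((norm v)\<^sup>2 + (norm (d k v))\<^sup>2)"

definition Vstar ::
  "(int \<Rightarrow> 'a::real_inner set) \<Rightarrow> (int \<Rightarrow> 'a set) \<Rightarrow> (int \<Rightarrow> 'a \<Rightarrow> 'a) \<Rightarrow> int \<Rightarrow> 'a set" where
  "Vstar W V d k = adjoint_dom (W (k - 1)) (V (k - 1)) (W k) (d (k - 1))"

definition dstar ::
  "(int \<Rightarrow> 'a::real_inner set) \<Rightarrow> (int \<Rightarrow> 'a set) \<Rightarrow> (int \<Rightarrow> 'a \<Rightarrow> 'a) \<Rightarrow> int \<Rightarrow> 'a \<Rightarrow> 'a" where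
  "dstar W V d k = adjoint_op (W (k - 1)) (V (k - 1)) (d (k - 1))"

definition VVstar_norm ::
  "(int \<Rightarrow> 'a::real_inner set) \<Rightarrow> (int \<Rightarrow> 'a set) \<Rightarrow> (int \<Rightarrow> 'a \<Rightarrow> 'a) \<Rightarrow> int \<Rightarrow> 'a \<Rightarrow> real" where
  "VVstar_norm W V d k v = sqrt ((norm v)\<^sup>2 + (norm (d k v))\<^sup>2 + (norm (dstar W V d k v))\<^sup>2)"

definition compactness_property ::
  "(int \<Rightarrow> 'a::{real_inner,complete_space} set) \<Rightarrow> (int \<Rightarrow> 'a set) \<Rightarrow> (int \<Rightarrow> 'a \<Rightarrow> 'a) \<Rightarrow> bool" where
  "compactness_property W V d \<longleftrightarrow> (\<forall>k.
     compact_op (V k \<inter> Vstar W V d k) (VVstar_norm W V d k) (W k) (\<lambda>v. v) \<and>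
     W k \<subseteq> closure (V k \<inter> Vstar W V d k))"


text \<open>The dual of a normed space carried by \<open>X\<close>. Functionals are made \<^const>\<open>extensional\<close> (fixed to
  \<^const>\<open>undefined\<close> off \<open>X\<close>) so that equality of functionals is equality on \<open>X\<close>.\<close>

definition dual_space :: "'a::real_vector set \<Rightarrow> ('a \<Rightarrow> real) \<Rightarrow> ('a \<Rightarrow> real) set" where
  "dual_space X nrm =
     {\<phi> \<in> extensional X. linear_map X UNIV \<phi> \<and> (\<exists>C. \<forall>v\<in>X. \<bar>\<phi> v\<bar> \<le> C * nrm v)}"

definition dual_norm :: "'a::real_vector set \<Rightarrow> ('a \<Rightarrow> real) \<Rightarrow> ('a \<Rightarrow> real) \<Rightarrow> real" where
  "dual_norm X nrm \<phi> = (SUP v\<in>{v\<in>X. nrm v \<le> 1}. \<bar>\<phi> v\<bar>)"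

definition bounded_iso_to_dual ::
  "'a::real_vector set \<Rightarrow> ('a \<Rightarrow> real) \<Rightarrow> ('a \<Rightarrow> 'a \<Rightarrow> real) \<Rightarrow> bool" where
  "bounded_iso_to_dual X nrm L \<longleftrightarrow>
     bij_betw L X (dual_space X nrm) \<and>
     (\<forall>v\<in>X. linear_map X UNIV (\<lambda>u. L u v)) \<and>
     (\<exists>C. \<forall>u\<in>X. dual_norm X nrm (L u) \<le> C * nrm u) \<and>
     (\<exists>C. \<forall>u\<in>X. nrm u \<le> C * dual_norm X nrm (L u))"

text \<open>The inclusion of the pivot space into the dual of \<open>X\<close>.\<close>

definition as_functional :: "'a::real_inner set \<Rightarrow> 'a \<Rightarrow> 'a \<Rightarrow> real" where
  "as_functional X f = restrict (\<lambda>v. f \<bullet> v) X"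

definition dual_operator :: "'a set \<Rightarrow> ('a \<Rightarrow> 'a \<Rightarrow> real) \<Rightarrow> 'a \<Rightarrow> 'a \<Rightarrow> real" where
  "dual_operator X L z = restrict (\<lambda>v. L v z) X"

definition lower_order_operator ::
  "(int \<Rightarrow> 'a::real_inner set) \<Rightarrow> (int \<Rightarrow> 'a set) \<Rightarrow> (int \<Rightarrow> 'a \<Rightarrow> 'a) \<Rightarrow> int \<Rightarrow>
   ('a \<Rightarrow> 'a) \<Rightarrow> ('a \<Rightarrow> 'a) \<Rightarrow> ('a \<Rightarrow> 'a) \<Rightarrow> ('a \<Rightarrow> 'a) \<Rightarrow> ('a \<Rightarrow> 'a) \<Rightarrow> 'a \<Rightarrow> 'a \<Rightarrow> real" where
  "lower_order_operator W V d k l1 l2 l3 l4 l5 u =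
     restrict (\<lambda>v.
       (dstar W V d k u + l2 u) \<bullet> (dstar W V d k v + adjoint_op (W (k - 1)) (W (k - 1)) l3 v)
       + (d k u + l1 u) \<bullet> d k v + l4 (d k u) \<bullet> v + l5 u \<bullet> v)
     (V k \<inter> Vstar W V d k)"


text \<open>Discrete spaces \<open>Vh h j\<close>, indexed by \<open>h > 0\<close>; nothing is assumed for \<open>h \<le> 0\<close>.\<close>

definition discrete_subcomplexes ::
  "(int \<Rightarrow> 'a::real_vector set) \<Rightarrow> (int \<Rightarrow> 'a \<Rightarrow> 'a) \<Rightarrow> (real \<Rightarrow> int \<Rightarrow> 'a set) \<Rightarrow> bool" where
  "discrete_subcomplexes V d Vh \<longleftrightarrow> (\<forall>h>0. \<forall>j.
     (\<exists>B. finite B \<and> Vh h j = span B) \<and> Vh h j \<subseteq> V j \<and> d j ` Vh h j \<subseteq> Vh h (j + 1))"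

definition dense_discrete ::
  "(int \<Rightarrow> 'a::real_inner set) \<Rightarrow> (int \<Rightarrow> 'a \<Rightarrow> 'a) \<Rightarrow> (real \<Rightarrow> int \<Rightarrow> 'a set) \<Rightarrow> bool" where
  "dense_discrete V d Vh \<longleftrightarrow>
     (\<forall>j. \<forall>u\<in>V j. ((\<lambda>h. INF v\<in>Vh h j. V_norm d j (u - v)) \<longlongrightarrow> 0) (at_right 0))"

definition bounded_cochain_projections ::
  "(int \<Rightarrow> 'a::real_inner set) \<Rightarrow> (int \<Rightarrow> 'a set) \<Rightarrow> (int \<Rightarrow> 'a \<Rightarrow> 'a) \<Rightarrow>
   (real \<Rightarrow> int \<Rightarrow> 'a set) \<Rightarrow> (real \<Rightarrow> int \<Rightarrow> 'a \<Rightarrow> 'a) \<Rightarrow> bool" where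
  "bounded_cochain_projections W V d Vh \<pi> \<longleftrightarrow>
     (\<forall>h>0. \<forall>j. linear_map (W j) (Vh h j) (\<pi> h j) \<and>
        (\<forall>v\<in>Vh h j. \<pi> h j v = v) \<and>
        (\<forall>v\<in>V j. d j (\<pi> h j v) = \<pi> h (j + 1) (d j v))) \<and>
     (\<forall>j. \<exists>C. \<forall>h>0. \<forall>w\<in>W j. norm (\<pi> h j w) \<le> C * norm w)"

definition mixed_galerkin_solution ::
  "(int \<Rightarrow> 'a::real_inner \<Rightarrow> 'a) \<Rightarrow> int \<Rightarrow>
   ('a \<Rightarrow> 'a) \<Rightarrow> ('a \<Rightarrow> 'a) \<Rightarrow> ('a \<Rightarrow> 'a) \<Rightarrow> ('a \<Rightarrow> 'a) \<Rightarrow> ('a \<Rightarrow> 'a) \<Rightarrow>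
   'a set \<Rightarrow> 'a set \<Rightarrow> 'a \<Rightarrow> 'a \<Rightarrow> 'a \<Rightarrow> bool" where
  "mixed_galerkin_solution d k l1 l2 l3 l4 l5 S U f \<sigma> u \<longleftrightarrow>
     \<sigma> \<in> S \<and> u \<in> U \<and>
     (\<forall>\<tau>\<in>S. \<sigma> \<bullet> \<tau> - u \<bullet> d (k - 1) \<tau> - l2 u \<bullet> \<tau> = 0) \<and>
     (\<forall>v\<in>U. (d (k - 1) \<sigma> + l3 \<sigma>) \<bullet> v + (d k u + l1 u) \<bullet> d k v + l4 (d k u) \<bullet> v + l5 u \<bullet> v = f \<bullet> v)"

end

theory Submission
  imports Defs "HOL-Library.Diagonal_Subsequence"
begin

text \<open>
  Existence follows from uniqueness in finite dimensions, so only the a priori bound is at stake.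
  If it fails, there are \<open>h \<rightarrow> 0\<close> and Galerkin solutions of total norm \<open>1\<close> with data tending to \<open>0\<close>.
  A weak limit of these solves the homogeneous continuous problem, hence vanishes because \<open>L\<close> is
  injective. The first Galerkin equation bounds the discrete \<open>d\<^sup>*u\<close>, and the cochain projections
  turn this and the compactness property into strong convergence of \<open>u\<close> in \<open>W\<close> along a subsequence.
  An energy estimate then forces all norms to \<open>0\<close>, a contradiction.
\<close>

section \<open>Weak compactness in Hilbert spaces\<close>

lemma orthogonal_projection_exists:
  fixes x :: "'b::{real_inner,complete_space}"
  assumes S: "subspace S" and cl: "closed S"
  obtains p where "p \<in> S" "\<And>s. s \<in> S \<Longrightarrow> (x - p) \<bullet> s = 0"
proof -
  define q where "q = (INF s\<in>S. (norm (x - s))\<^sup>2)"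
  have bdd: "bdd_below ((\<lambda>s. (norm (x - s))\<^sup>2) ` S)"
    by (rule bdd_belowI[of _ 0]) auto
  have ne: "S \<noteq> {}" using S subspace_0 by blast
  have q_le: "q \<le> (norm (x - s))\<^sup>2" if "s \<in> S" for s
    unfolding q_def by (rule cINF_lower[OF bdd that])
  have "\<exists>s\<in>S. (norm (x - s))\<^sup>2 < q + inverse (real (Suc n))" for n
    using cINF_less_iff[OF ne bdd, of "q + inverse (real (Suc n))"] unfolding q_def by simp
  then obtain s where sS: "s n \<in> S" and s: "(norm (x - s n))\<^sup>2 < q + inverse (real (Suc n))" for n
    by metis
  have near: "(norm (s m - s n))\<^sup>2 \<le> 2 * inverse (real (Suc m)) + 2 * inverse (real (Suc n))" for m n
  proof -
    have "(1/2) *\<^sub>R (s m + s n) \<in> S" using S sS by (simp add: subspace_add subspace_scale)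
    from q_le[OF this]
    have "4 * q \<le> 4 * (norm (x - (1/2) *\<^sub>R (s m + s n)))\<^sup>2" by simp
    also have "\<dots> = 2 * (norm (x - s m))\<^sup>2 + 2 * (norm (x - s n))\<^sup>2 - (norm (s m - s n))\<^sup>2"
      by (simp add: power2_norm_eq_inner algebra_simps inner_commute)
    finally show ?thesis using s[of m] s[of n] by linarith
  qed
  have "Cauchy s"
  proof (rule metric_CauchyI)
    fix e :: real assume "e > 0"
    then have "e\<^sup>2 / 4 > 0" by simp
    then obtain N where N: "inverse (real (Suc N)) < e\<^sup>2 / 4" using reals_Archimedean by blast
    show "\<exists>M. \<forall>m\<ge>M. \<forall>n\<ge>M. dist (s m) (s n) < e"
    proof (intro exI allI impI)
      fix m n assume "N \<le> m" "N \<le> n"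
      then have "inverse (real (Suc m)) \<le> inverse (real (Suc N))"
        "inverse (real (Suc n)) \<le> inverse (real (Suc N))" by auto
      with near[of m n] N have "(norm (s m - s n))\<^sup>2 < e\<^sup>2" by linarith
      then show "dist (s m) (s n) < e"
        unfolding dist_norm using \<open>e > 0\<close> power2_less_imp_less by fastforce
    qed
  qed
  then obtain p where p: "s \<longlonglongrightarrow> p" using Cauchy_convergent convergent_def by blast
  have pS: "p \<in> S" using closed_sequentially[OF cl _ p] sS by blast
  have "(norm (x - p))\<^sup>2 \<le> q + 0"
  proof (rule LIMSEQ_le)
    show "(\<lambda>n. (norm (x - s n))\<^sup>2) \<longlonglongrightarrow> (norm (x - p))\<^sup>2" by (intro tendsto_intros p)
    show "(\<lambda>n. q + inverse (real (Suc n))) \<longlonglongrightarrow> q + 0"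
      by (intro tendsto_intros LIMSEQ_inverse_real_of_nat)
  qed (use s less_imp_le in blast)
  then have min: "(norm (x - p))\<^sup>2 \<le> (norm (x - t))\<^sup>2" if "t \<in> S" for t
    using q_le[OF that] by linarith
  have "(x - p) \<bullet> t = 0" if "t \<in> S" for t
  proof (cases "t = 0")
    case False
    define c where "c = ((x - p) \<bullet> t) / (t \<bullet> t)"
    have "p + c *\<^sub>R t \<in> S" using S pS that by (simp add: subspace_add subspace_scale)
    from min[OF this] have "0 \<le> c * c * (t \<bullet> t) - 2 * c * ((x - p) \<bullet> t)"
      by (simp add: power2_norm_eq_inner algebra_simps inner_commute)
    also have "\<dots> = - (((x - p) \<bullet> t)\<^sup>2 / (t \<bullet> t))"
      using False by (simp add: c_def power2_eq_square field_simps)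
    finally have "((x - p) \<bullet> t)\<^sup>2 / (t \<bullet> t) \<le> 0" by simp
    moreover have "t \<bullet> t > 0" using False by simp
    ultimately have "((x - p) \<bullet> t)\<^sup>2 \<le> 0" by (simp add: divide_le_0_iff)
    then show ?thesis by simp
  qed simp
  then show ?thesis using that pS by blast
qed

lemma riesz_representation:
  fixes S :: "'b::{real_inner,complete_space} set"
  assumes S: "subspace S" and cl: "closed S"
    and lin: "linear_map S UNIV \<phi>" and bd: "\<And>s. s \<in> S \<Longrightarrow> \<bar>\<phi> s\<bar> \<le> C * norm s"
  obtains z where "z \<in> S" "\<And>s. s \<in> S \<Longrightarrow> \<phi> s = s \<bullet> z"
proof -
  have add: "\<phi> (s + t) = \<phi> s + \<phi> t" and scale: "\<phi> (c *\<^sub>R s) = c * \<phi> s"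
    if "s \<in> S" "t \<in> S" for s t c
    using lin that unfolding linear_map_def by auto
  have diff: "\<phi> (s - t) = \<phi> s - \<phi> t" if "s \<in> S" "t \<in> S" for s t
    using add[OF that(1), of "(-1) *\<^sub>R t"] scale[OF that(2,2), of "-1"] that S
    by (simp add: subspace_neg)
  have cont: "continuous_on S \<phi>"
  proof (rule lipschitz_on_continuous_on)
    show "(max C 0)-lipschitz_on S \<phi>"
    proof (rule lipschitz_onI)
      fix s t assume st: "s \<in> S" "t \<in> S"
      have "dist (\<phi> s) (\<phi> t) = \<bar>\<phi> (s - t)\<bar>" using diff[OF st] by (simp add: dist_real_def)
      also have "\<dots> \<le> C * norm (s - t)" using bd st S by (simp add: subspace_diff)
      also have "\<dots> \<le> max C 0 * norm (s - t)" by (rule mult_right_mono) auto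
      finally show "dist (\<phi> s) (\<phi> t) \<le> max C 0 * dist s t" by (simp add: dist_norm)
    qed simp
  qed
  define N where "N = {s\<in>S. \<phi> s = 0}"
  have clN: "closed N"
    unfolding N_def by (rule continuous_closed_preimage_constant[OF cont cl])
  have "\<phi> 0 = 0" using scale[of 0 0 0] S by (simp add: subspace_0)
  then have subN: "subspace N"
    using S add scale unfolding N_def subspace_def by auto
  show ?thesis
  proof (cases "N = S")
    case True
    then show ?thesis using that[of 0] S unfolding N_def by (auto simp: subspace_0)
  next
    case False
    then obtain x where x: "x \<in> S" "\<phi> x \<noteq> 0" unfolding N_def by auto
    obtain p where p: "p \<in> N" "\<And>s. s \<in> N \<Longrightarrow> (x - p) \<bullet> s = 0"
      using orthogonal_projection_exists[OF subN clN] by blast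
    define y where "y = x - p"
    have y: "y \<in> S" "\<phi> y \<noteq> 0"
      using x p(1) diff[of x p] S unfolding y_def N_def by (auto simp: subspace_diff)
    then have y0: "y \<noteq> 0" using \<open>\<phi> 0 = 0\<close> by auto
    show ?thesis
    proof (rule that[of "(\<phi> y / (y \<bullet> y)) *\<^sub>R y"])
      show "(\<phi> y / (y \<bullet> y)) *\<^sub>R y \<in> S" using y S by (simp add: subspace_scale)
      fix s assume s: "s \<in> S"
      have "s - (\<phi> s / \<phi> y) *\<^sub>R y \<in> N"
        using s y S diff scale unfolding N_def by (simp add: subspace_diff subspace_scale)
      from p(2)[OF this] have "s \<bullet> y = \<phi> s / \<phi> y * (y \<bullet> y)"
        by (simp add: y_def[symmetric] inner_diff_right inner_commute)
      then show "\<phi> s = s \<bullet> ((\<phi> y / (y \<bullet> y)) *\<^sub>R y)" using y y0 by simp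
    qed
  qed
qed

definition weakly_converges :: "(nat \<Rightarrow> 'b::real_inner) \<Rightarrow> 'b \<Rightarrow> bool" where
  "weakly_converges x z \<longleftrightarrow> (\<forall>y. (\<lambda>n. x n \<bullet> y) \<longlonglongrightarrow> z \<bullet> y)"

lemma closed_convergent_inner:
  fixes x :: "nat \<Rightarrow> 'b::real_inner"
  assumes bd: "\<And>n. norm (x n) \<le> C"
  shows "closed {y. convergent (\<lambda>n. x n \<bullet> y)}"
  unfolding closed_sequential_limits
proof (intro allI impI, elim conjE)
  fix t y assume t: "\<forall>j. t j \<in> {y. convergent (\<lambda>n. x n \<bullet> y)}" and y: "t \<longlonglongrightarrow> y"
  have C0: "0 \<le> C" using bd[of 0] norm_ge_zero order_trans by blast
  have "Cauchy (\<lambda>n. x n \<bullet> y)"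
  proof (rule metric_CauchyI)
    fix e :: real assume e: "e > 0"
    then have "e / (3 * (C + 1)) > 0" using C0 by simp
    then obtain j where "dist (t j) y < e / (3 * (C + 1))"
      using y unfolding lim_sequentially by blast
    then have j: "(C + 1) * norm (y - t j) < e / 3"
      using C0 by (simp add: dist_norm norm_minus_commute field_simps)
    have close: "\<bar>x n \<bullet> y - x n \<bullet> t j\<bar> < e / 3" for n
    proof -
      have "\<bar>x n \<bullet> y - x n \<bullet> t j\<bar> = \<bar>x n \<bullet> (y - t j)\<bar>" by (simp add: inner_diff_right)
      also have "\<dots> \<le> norm (x n) * norm (y - t j)" by (rule Cauchy_Schwarz_ineq2)
      also have "\<dots> \<le> (C + 1) * norm (y - t j)" using bd[of n] by (intro mult_right_mono) auto
      finally show ?thesis using j by simp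
    qed
    have "Cauchy (\<lambda>n. x n \<bullet> t j)" using t convergent_Cauchy by blast
    then obtain M where M: "\<And>m n. m \<ge> M \<Longrightarrow> n \<ge> M \<Longrightarrow> dist (x m \<bullet> t j) (x n \<bullet> t j) < e / 3"
      using e metric_CauchyD[of _ "e / 3"] by (metis divide_pos_pos zero_less_numeral)
    show "\<exists>M. \<forall>m\<ge>M. \<forall>n\<ge>M. dist (x m \<bullet> y) (x n \<bullet> y) < e"
    proof (intro exI allI impI)
      fix m n assume "M \<le> m" "M \<le> n"
      from M[OF this] close[of m] close[of n] show "dist (x m \<bullet> y) (x n \<bullet> y) < e"
        unfolding dist_real_def by linarith
    qed
  qed
  then show "y \<in> {y. convergent (\<lambda>n. x n \<bullet> y)}" by (simp add: Cauchy_convergent)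
qed

lemma subspace_closure:
  fixes S :: "'b::real_normed_vector set"
  assumes S: "subspace S"
  shows "subspace (closure S)"
  unfolding subspace_def
proof (intro conjI ballI allI)
  show "0 \<in> closure S" using subspace_0[OF S] closure_subset by blast
next
  fix x y assume "x \<in> closure S" "y \<in> closure S"
  then obtain a b where "\<And>n. a n \<in> S" "a \<longlonglongrightarrow> x" "\<And>n. b n \<in> S" "b \<longlonglongrightarrow> y"
    unfolding closure_sequential by blast
  then have "\<forall>n. a n + b n \<in> S" "(\<lambda>n. a n + b n) \<longlonglongrightarrow> x + y"
    by (simp_all add: subspace_add[OF S] tendsto_add)
  then show "x + y \<in> closure S"
    unfolding closure_sequential by (intro exI[of _ "\<lambda>n. a n + b n"] conjI)
next
  fix c x assume "x \<in> closure S"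
  then obtain a where "\<And>n. a n \<in> S" "a \<longlonglongrightarrow> x"
    unfolding closure_sequential by blast
  then have "\<forall>n. c *\<^sub>R a n \<in> S" "(\<lambda>n. c *\<^sub>R a n) \<longlonglongrightarrow> c *\<^sub>R x"
    by (simp_all add: subspace_scale[OF S] tendsto_scaleR)
  then show "c *\<^sub>R x \<in> closure S"
    unfolding closure_sequential by (intro exI[of _ "\<lambda>n. c *\<^sub>R a n"] conjI)
qed

lemma weakly_convergent_subsequence:
  fixes x :: "nat \<Rightarrow> 'b::{real_inner,complete_space}"
  assumes S: "subspace S" and cl: "closed S"
    and xS: "\<And>n. x n \<in> S" and bd: "\<And>n. norm (x n) \<le> C"
  obtains r z where "strict_mono r" "z \<in> S" "weakly_converges (x \<circ> r) z"
proof -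
  have C0: "0 \<le> C" using bd[of 0] norm_ge_zero order_trans by blast
  have ip: "\<bar>x n \<bullet> y\<bar> \<le> C * norm y" for n y
    using Cauchy_Schwarz_ineq2[of "x n" y] bd[of n] mult_right_mono[of "norm (x n)" C "norm y"]
    by force
  interpret subseqs "\<lambda>m s. convergent (\<lambda>i. x (s i) \<bullet> x m)"
  proof
    fix m :: nat and s :: "nat \<Rightarrow> nat" assume "strict_mono s"
    have "bounded (range (\<lambda>i. x (s i) \<bullet> x m))"
      using ip by (auto simp: bounded_iff)
    then obtain l r where "strict_mono r" "((\<lambda>i. x (s i) \<bullet> x m) \<circ> r) \<longlonglongrightarrow> l"
      using bounded_imp_convergent_subsequence by blast
    then show "\<exists>r'. strict_mono r' \<and> convergent (\<lambda>i. x ((s \<circ> r') i) \<bullet> x m)"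
      unfolding convergent_def by (auto simp: o_def)
  qed
  define r where "r = diagseq"
  have r: "strict_mono r" unfolding r_def by (rule subseq_diagseq)
  have "convergent (\<lambda>i. x (r i) \<bullet> x m)" for m
  proof -
    have "convergent (\<lambda>i. x ((diagseq \<circ> (+) (Suc m)) i) \<bullet> x m)"
    proof (rule diagseq_holds)
      fix r s :: "nat \<Rightarrow> nat" and n assume "strict_mono r" "convergent (\<lambda>i. x (s i) \<bullet> x n)"
      then show "convergent (\<lambda>i. x ((s \<circ> r) i) \<bullet> x n)"
        using convergent_subseq_convergent[of "\<lambda>i. x (s i) \<bullet> x n" r] by (simp add: o_def)
    qed
    then have "convergent (\<lambda>i. x (r (i + Suc m)) \<bullet> x m)"
      by (simp add: r_def o_def add.commute)
    then show ?thesis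
      using convergent_ignore_initial_segment[of "\<lambda>i. x (r i) \<bullet> x m" "Suc m"] by simp
  qed
  define G where "G = {y. convergent (\<lambda>n. (x \<circ> r) n \<bullet> y)}"
  have clG: "closed G" unfolding G_def by (rule closed_convergent_inner[of _ C]) (simp add: bd)
  have subG: "subspace G"
    unfolding G_def subspace_def mem_Collect_eq inner_add_right inner_zero_right inner_scaleR_right
    by (intro conjI ballI allI convergent_const convergent_add convergent_mult) simp_all
  define M where "M = closure (span (range x))"
  have "range x \<subseteq> G" using \<open>\<And>m. convergent (\<lambda>i. x (r i) \<bullet> x m)\<close> by (auto simp: G_def)
  then have MG: "M \<subseteq> G"
    unfolding M_def by (intro closure_minimal span_minimal subG clG)
  have subM: "subspace M" unfolding M_def by (intro subspace_closure subspace_span)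
  have xM: "x n \<in> M" for n
    unfolding M_def using closure_subset[of "span (range x)"] span_base[of "x n" "range x"] by auto
  have all: "convergent (\<lambda>n. x (r n) \<bullet> y)" for y
  proof -
    obtain p where p: "p \<in> M" "\<And>s. s \<in> M \<Longrightarrow> (y - p) \<bullet> s = 0"
      using orthogonal_projection_exists[OF subM, of y] by (auto simp: M_def)
    have "x (r n) \<bullet> y = x (r n) \<bullet> p" for n
      using p(2)[OF xM, of "r n"] by (simp add: inner_diff_left inner_commute)
    then show ?thesis using p(1) MG by (auto simp: G_def)
  qed
  define \<phi> where "\<phi> y = lim (\<lambda>n. x (r n) \<bullet> y)" for y
  have lim: "(\<lambda>n. x (r n) \<bullet> y) \<longlonglongrightarrow> \<phi> y" for y
    unfolding \<phi>_def using all by (simp add: convergent_LIMSEQ_iff)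
  have "\<phi> (y + y') = \<phi> y + \<phi> y'" for y y'
    by (rule LIMSEQ_unique[OF lim]) (simp add: inner_add_right tendsto_add[OF lim lim])
  moreover have "\<phi> (c *\<^sub>R y) = c * \<phi> y" for c y
    by (rule LIMSEQ_unique[OF lim]) (simp add: tendsto_mult_left[OF lim])
  ultimately have lin: "linear_map UNIV UNIV \<phi>" by (simp add: linear_map_def)
  have "\<bar>\<phi> y\<bar> \<le> C * norm y" for y
    by (rule LIMSEQ_le_const2[OF tendsto_rabs[OF lim]]) (simp add: ip)
  then obtain z where z: "\<And>y. \<phi> y = z \<bullet> y"
    using riesz_representation[OF subspace_UNIV closed_UNIV lin, of C] by (metis UNIV_I inner_commute)
  obtain p where p: "p \<in> S" "\<And>s. s \<in> S \<Longrightarrow> (z - p) \<bullet> s = 0"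
    using orthogonal_projection_exists[OF S cl] by blast
  have "x (r n) \<bullet> (z - p) = 0" for n
    using p(2)[OF xS, of "r n"] by (simp add: inner_commute)
  then have "\<phi> (z - p) = 0" using LIMSEQ_unique[OF lim, of "z - p" 0] by simp
  then have "z \<bullet> (z - p) = 0" by (simp only: z)
  moreover have "p \<bullet> (z - p) = 0" using p by (simp add: inner_commute)
  ultimately have "(z - p) \<bullet> (z - p) = 0" by (simp only: inner_diff_left)
  then have zp: "z = p" by simp
  have "weakly_converges (x \<circ> r) p"
    using lim by (simp only: weakly_converges_def z zp o_def) simp
  then show ?thesis using that[OF r p(1)] by blast
qed

lemma weakly_converges_subseq:
  "weakly_converges x z \<Longrightarrow> strict_mono r \<Longrightarrow> weakly_converges (x \<circ> r) z"
  unfolding weakly_converges_def using LIMSEQ_subseq_LIMSEQ by (fastforce simp: o_def)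

lemma weakly_converges_inner:
  fixes x :: "nat \<Rightarrow> 'b::real_inner"
  assumes "weakly_converges x z" and bd: "\<And>n. norm (x n) \<le> C" and "y \<longlonglongrightarrow> y0"
  shows "(\<lambda>n. x n \<bullet> y n) \<longlonglongrightarrow> z \<bullet> y0"
proof -
  have "(\<lambda>n. C * norm (y n - y0)) \<longlonglongrightarrow> C * norm (y0 - y0)" by (intro tendsto_intros assms)
  then have 1: "(\<lambda>n. C * norm (y n - y0)) \<longlonglongrightarrow> 0" by simp
  have "(\<lambda>n. x n \<bullet> (y n - y0)) \<longlonglongrightarrow> 0"
  proof (rule Lim_null_comparison[OF _ 1])
    have "norm (x n \<bullet> (y n - y0)) \<le> C * norm (y n - y0)" for n
      using Cauchy_Schwarz_ineq2[of "x n" "y n - y0"] bd[of n]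
        mult_right_mono[of "norm (x n)" C "norm (y n - y0)"] by force
    then show "\<forall>\<^sub>F n in sequentially. norm (x n \<bullet> (y n - y0)) \<le> C * norm (y n - y0)" by simp
  qed
  moreover have "(\<lambda>n. x n \<bullet> y0) \<longlonglongrightarrow> z \<bullet> y0" using assms(1) by (simp add: weakly_converges_def)
  ultimately have "(\<lambda>n. x n \<bullet> (y n - y0) + x n \<bullet> y0) \<longlonglongrightarrow> 0 + z \<bullet> y0" by (rule tendsto_add)
  then show ?thesis by (simp add: inner_diff_right)
qed

lemma bounded_op_adjoint:
  fixes A :: "'b::{real_inner,complete_space} set" and T :: "'b \<Rightarrow> 'c::real_inner"
  assumes A: "subspace A" "closed A" and T: "bounded_op A B T"
  obtains z where "z \<in> A" "\<And>x. x \<in> A \<Longrightarrow> T x \<bullet> y = x \<bullet> z"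
proof -
  obtain C where lin: "linear_map A B T" and C: "\<And>x. x \<in> A \<Longrightarrow> norm (T x) \<le> C * norm x"
    using T unfolding bounded_op_def by blast
  show ?thesis
  proof (rule riesz_representation[OF A])
    show "linear_map A UNIV (\<lambda>x. T x \<bullet> y)"
      using lin by (simp add: linear_map_def inner_add_left)
    show "\<bar>T x \<bullet> y\<bar> \<le> (C * norm y) * norm x" if "x \<in> A" for x
      using Cauchy_Schwarz_ineq2[of "T x" y] mult_right_mono[OF C[OF that], of "norm y"]
      by (simp add: mult_ac)
  qed (use that in blast)
qed

lemma weakly_converges_bounded_op:
  fixes A :: "'b::{real_inner,complete_space} set" and T :: "'b \<Rightarrow> 'c::real_inner"
  assumes A: "subspace A" "closed A" and T: "bounded_op A B T"
    and x: "weakly_converges x z" "\<And>n. x n \<in> A" "z \<in> A"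
  shows "weakly_converges (\<lambda>n. T (x n)) (T z)"
  unfolding weakly_converges_def
proof
  fix y
  obtain w where "\<And>x. x \<in> A \<Longrightarrow> T x \<bullet> y = x \<bullet> w"
    using bounded_op_adjoint[OF A T] by blast
  with x show "(\<lambda>n. T (x n) \<bullet> y) \<longlonglongrightarrow> T z \<bullet> y" by (simp add: weakly_converges_def)
qed

section \<open>Finite-dimensional linear systems\<close>

lemma linear_map_0: "linear_map A B T \<Longrightarrow> 0 \<in> A \<Longrightarrow> T 0 = 0"
  unfolding linear_map_def using scaleR_zero_left by metis

lemma linear_map_add: "linear_map A B T \<Longrightarrow> x \<in> A \<Longrightarrow> y \<in> A \<Longrightarrow> T (x + y) = T x + T y"
  unfolding linear_map_def by blast

lemma linear_map_scale: "linear_map A B T \<Longrightarrow> x \<in> A \<Longrightarrow> T (c *\<^sub>R x) = c *\<^sub>R T x"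
  unfolding linear_map_def by blast

lemma linear_map_diff:
  assumes T: "linear_map A B T" and A: "subspace A" and xy: "x \<in> A" "y \<in> A"
  shows "T (x - y) = T x - T y"
  using linear_map_add[OF T xy(1) subspace_neg[OF A xy(2)]] linear_map_scale[OF T xy(2), of "-1"]
  by simp

lemma solvable_if_unique:
  fixes \<beta> :: "'b::real_vector \<Rightarrow> 'b \<Rightarrow> real"
  assumes F: "finite F" and M: "M = span F"
    and l: "\<And>y. y \<in> M \<Longrightarrow> linear_map M UNIV (\<lambda>x. \<beta> x y)"
    and r: "\<And>x. x \<in> M \<Longrightarrow> linear_map M UNIV (\<beta> x)"
    and inj: "\<And>x. x \<in> M \<Longrightarrow> (\<And>y. y \<in> M \<Longrightarrow> \<beta> x y = 0) \<Longrightarrow> x = 0"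
    and \<phi>: "linear_map M UNIV \<phi>"
  shows "\<exists>x\<in>M. \<forall>y\<in>M. \<beta> x y = \<phi> y"
proof -
  obtain B where BF: "B \<subseteq> F" and ind: "independent B" and FB: "F \<subseteq> span B"
    using maximal_independent_subset[of F] by blast
  have finB: "finite B" using BF F finite_subset by blast
  have MB: "M = span B"
    unfolding M using BF FB span_mono[of B F] span_minimal[OF FB subspace_span] by blast
  have BM: "b \<in> M" if "b \<in> B" for b using that MB span_base by blast
  have subM: "subspace M" by (simp add: M)
  have eq_span: "f y = g y"
    if "y \<in> M" and f: "linear_map M UNIV f" and g: "linear_map M UNIV g"
      and b: "\<And>b. b \<in> B \<Longrightarrow> f b = g b" for f g :: "'b \<Rightarrow> real" and y
  proof -
    define E where "E = {y\<in>M. f y = g y}"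
    have "f 0 = 0" "g 0 = 0"
      using f g subspace_0[OF subM] by (blast intro: linear_map_0)+
    then have "subspace E"
      using subM by (auto simp: E_def subspace_def linear_map_add[OF f] linear_map_add[OF g]
        linear_map_scale[OF f] linear_map_scale[OF g])
    moreover have "B \<subseteq> E" using b BM by (auto simp: E_def)
    ultimately have "span B \<subseteq> E" by (rule span_minimal[rotated])
    then show ?thesis using that(1) MB by (auto simp: E_def)
  qed
  define T0 where "T0 x = (\<Sum>b\<in>B. \<beta> x b *\<^sub>R b)" for x
  define T where "T = construct B T0"
  have linT: "linear T" unfolding T_def by (rule linear_construct[OF ind])
  have T_M: "T x = T0 x" if "x \<in> M" for x
  proof -
    define E where "E = {x\<in>M. T x = T0 x}"
    have \<beta>add: "\<beta> (x + x') b = \<beta> x b + \<beta> x' b" and \<beta>sc: "\<beta> (c *\<^sub>R x) b = c * \<beta> x b"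
      if "x \<in> M" "x' \<in> M" "b \<in> B" for x x' b c
      using linear_map_add[OF l[OF BM[OF that(3)]]] linear_map_scale[OF l[OF BM[OF that(3)]]] that
      by auto
    have \<beta>0: "\<beta> 0 b = 0" if "b \<in> B" for b
      using \<beta>sc[of 0 0 b 0] that subspace_0[OF subM] by simp
    have "T0 (x + x') = T0 x + T0 x'" if "x \<in> M" "x' \<in> M" for x x'
      unfolding T0_def sum.distrib[symmetric]
      by (rule sum.cong) (simp_all add: \<beta>add[OF that] scaleR_add_left)
    moreover have "T0 (c *\<^sub>R x) = c *\<^sub>R T0 x" if "x \<in> M" for x c
      unfolding T0_def scaleR_sum_right
      by (rule sum.cong) (simp_all add: \<beta>sc[OF that that])
    moreover have "T0 0 = 0" unfolding T0_def by (simp add: \<beta>0)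
    ultimately have "subspace E"
      using subM by (auto simp: E_def subspace_def linear_add[OF linT] linear_scale[OF linT]
        linear_0[OF linT])
    moreover have "B \<subseteq> E" using BM construct_basis[OF ind, of _ T0] by (auto simp: E_def T_def)
    ultimately have "span B \<subseteq> E" by (rule span_minimal[rotated])
    then show ?thesis using that MB by (auto simp: E_def)
  qed
  have coeff: "p b = q b" if "(\<Sum>b\<in>B. p b *\<^sub>R b) = (\<Sum>b\<in>B. q b *\<^sub>R b)" "b \<in> B" for p q b
  proof -
    have "(\<Sum>b\<in>B. (p b - q b) *\<^sub>R b) = 0"
      using that(1) by (simp add: scaleR_diff_left sum_subtractf)
    from independentD[OF ind finB order_refl this that(2)] show ?thesis by simp
  qed
  have injs: "inj_on T (span B)"
    unfolding linear_inj_on_iff_eq_0[OF linT subspace_span]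
  proof (intro ballI impI)
    fix x assume x: "x \<in> span B" "T x = 0"
    then have xM: "x \<in> M" using MB by simp
    have "(\<Sum>b\<in>B. \<beta> x b *\<^sub>R b) = (\<Sum>b\<in>B. 0 *\<^sub>R b)" using x T_M[OF xM] by (simp add: T0_def)
    from coeff[OF this] have "\<beta> x b = 0" if "b \<in> B" for b using that by simp
    then have "\<beta> x y = 0" if "y \<in> M" for y
      using eq_span[OF that r[OF xM], of "\<lambda>_. 0"] by (simp add: linear_map_def)
    then show "x = 0" using inj[OF xM] by blast
  qed
  have indT: "independent (T ` B)" by (rule linear_independent_injective_image[OF linT ind injs])
  have inj: "inj_on T B" by (rule inj_on_subset[OF injs span_superset])
  have TM: "T ` B \<subseteq> span B"
    using T_M[OF BM] by (auto simp: T0_def intro!: span_sum span_scale intro: span_base)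
  have "b \<in> span (T ` B)" if b: "b \<in> B" for b
  proof (rule ccontr)
    assume nb: "b \<notin> span (T ` B)"
    then have "independent (insert b (T ` B))" using indT by (simp add: independent_insert)
    moreover have "insert b (T ` B) \<subseteq> span B" using TM span_base[OF b] by blast
    ultimately have "card (insert b (T ` B)) \<le> card B"
      using independent_span_bound[OF finB] by blast
    moreover have "b \<notin> T ` B" using nb span_base[of b "T ` B"] by blast
    ultimately show False using finB by (simp add: card_image[OF inj])
  qed
  then have "span B \<subseteq> span (T ` B)" by (intro span_minimal subspace_span) blast
  also have "\<dots> = T ` M" using MB linear_span_image[OF linT] by simp
  finally have onto: "M \<subseteq> T ` M" using MB by simp
  have "(\<Sum>b\<in>B. \<phi> b *\<^sub>R b) \<in> M" unfolding MB by (intro span_sum span_scale span_base)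
  then obtain x where x: "x \<in> M" "T x = (\<Sum>b\<in>B. \<phi> b *\<^sub>R b)" using onto by force
  then have "(\<Sum>b\<in>B. \<beta> x b *\<^sub>R b) = (\<Sum>b\<in>B. \<phi> b *\<^sub>R b)" using T_M by (simp add: T0_def)
  from coeff[OF this] have "\<beta> x y = \<phi> y" if "y \<in> M" for y
    using eq_span[OF that r[OF x(1)] \<phi>] by blast
  then show ?thesis using x by blast
qed

section \<open>Hilbert complexes\<close>

locale hilbert_complex_locale =
  fixes W V :: "int \<Rightarrow> 'a::{real_inner,complete_space} set" and d :: "int \<Rightarrow> 'a \<Rightarrow> 'a"
  assumes complex: "hilbert_complex W V d"
begin

lemma subspace_W: "subspace (W j)" and closed_W: "closed (W j)"
  and subspace_V: "subspace (V j)" and V_subset_W: "V j \<subseteq> W j" and dense_V: "W j \<subseteq> closure (V j)"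
  and d_linear: "linear_map (V j) (W (j + 1)) (d j)"
  and closed_graph: "closed {(v, d j v) | v. v \<in> V j}"
  and closed_range: "closed (d j ` V j)"
  using complex unfolding hilbert_complex_def by blast+

lemma d_in_V: "v \<in> V j \<Longrightarrow> d j v \<in> V (j + 1)" and d_d: "v \<in> V j \<Longrightarrow> d (j + 1) (d j v) = 0"
  using complex unfolding hilbert_complex_def by blast+

lemma d_prev_in_V: "v \<in> V (j - 1) \<Longrightarrow> d (j - 1) v \<in> V j"
  and d_d_prev: "v \<in> V (j - 1) \<Longrightarrow> d j (d (j - 1) v) = 0"
  using d_in_V[of v "j - 1"] d_d[of v "j - 1"] by simp_all

lemmas d_add = linear_map_add[OF d_linear]
  and d_scale = linear_map_scale[OF d_linear]
  and d_diff = linear_map_diff[OF d_linear subspace_V]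
  and d_0 = linear_map_0[OF d_linear subspace_0[OF subspace_V]]

lemma in_W: "v \<in> V j \<Longrightarrow> v \<in> W j"
  using V_subset_W by blast

lemma d_closed:
  assumes "\<And>n. v n \<in> V j" "v \<longlonglongrightarrow> v0" "(\<lambda>n. d j (v n)) \<longlonglongrightarrow> w0"
  shows "v0 \<in> V j" "d j v0 = w0"
proof -
  have "(v0, w0) \<in> {(v, d j v) | v. v \<in> V j}"
    by (rule closed_sequentially[OF closed_graph, of "\<lambda>n. (v n, d j (v n))"])
      (use assms in \<open>auto intro: tendsto_Pair\<close>)
  then show "v0 \<in> V j" "d j v0 = w0" by auto
qed

lemma subspace_graph: "subspace {(v, d j v) | v. v \<in> V j}"
proof -
  have "(0, 0) \<in> {(v, d j v) | v. v \<in> V j}" using subspace_0[OF subspace_V] d_0 by force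
  then show ?thesis
    using subspace_add[OF subspace_V] subspace_scale[OF subspace_V] d_add d_scale
    unfolding subspace_def zero_prod_def by (force simp: d_add d_scale)
qed

lemma subspace_range: "subspace (d j ` V j)"
proof -
  have "0 \<in> d j ` V j" using subspace_0[OF subspace_V] d_0 by (metis imageI)
  moreover have "d j v + d j w \<in> d j ` V j" if "v \<in> V j" "w \<in> V j" for v w
    using that subspace_add[OF subspace_V that] d_add[OF that] by (metis imageI)
  moreover have "c *\<^sub>R d j v \<in> d j ` V j" if "v \<in> V j" for c v
    using subspace_scale[OF subspace_V that] d_scale[OF that] by (metis imageI)
  ultimately show ?thesis unfolding subspace_def by blast
qed

lemma subspace_kernel: "subspace {v \<in> V j. d j v = 0}"
  using subspace_V[of j] unfolding subspace_def by (auto simp: d_0 d_add d_scale)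

lemma closed_kernel: "closed {v \<in> V j. d j v = 0}"
  unfolding closed_sequential_limits
proof (intro allI impI, elim conjE)
  fix v v0 assume "\<forall>n. v n \<in> {v \<in> V j. d j v = 0}" "v \<longlonglongrightarrow> v0"
  then have "\<And>n. v n \<in> V j" "v \<longlonglongrightarrow> v0" "(\<lambda>n. d j (v n)) \<longlonglongrightarrow> 0" by auto
  from d_closed[OF this] show "v0 \<in> {v \<in> V j. d j v = 0}" by simp
qed

lemma eq_0_if_orthogonal_V:
  assumes z: "z \<in> W j" and o: "\<And>v. v \<in> V j \<Longrightarrow> z \<bullet> v = 0"
  shows "z = 0"
proof -
  have "z \<in> closure (V j)" using z dense_V by blast
  then obtain v where "\<And>n. v n \<in> V j" "v \<longlonglongrightarrow> z" unfolding closure_sequential by blast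
  then have "(\<lambda>n. z \<bullet> v n) \<longlonglongrightarrow> z \<bullet> z" by (intro tendsto_intros)
  moreover have "z \<bullet> v n = 0" for n using o[OF \<open>v n \<in> V j\<close>] .
  ultimately have "z \<bullet> z = 0" by (simp add: LIMSEQ_const_iff)
  then show ?thesis by simp
qed

lemma Vstar_dstarI:
  assumes x: "x \<in> W j" and z: "z \<in> W (j - 1)"
    and eq: "\<And>v. v \<in> V (j - 1) \<Longrightarrow> d (j - 1) v \<bullet> x = v \<bullet> z"
  shows "x \<in> Vstar W V d j" "dstar W V d j x = z"
proof -
  show "x \<in> Vstar W V d j" using assms unfolding Vstar_def adjoint_dom_def by blast
  show "dstar W V d j x = z"
    unfolding dstar_def adjoint_op_def
  proof (rule the_equality)
    show "z \<in> W (j - 1) \<and> (\<forall>v\<in>V (j - 1). d (j - 1) v \<bullet> x = v \<bullet> z)" using z eq by blast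
    fix y assume y: "y \<in> W (j - 1) \<and> (\<forall>v\<in>V (j - 1). d (j - 1) v \<bullet> x = v \<bullet> y)"
    have "y - z = 0"
    proof (rule eq_0_if_orthogonal_V)
      show "y - z \<in> W (j - 1)" using y z subspace_W by (simp add: subspace_diff)
      show "(y - z) \<bullet> v = 0" if "v \<in> V (j - 1)" for v
        using y eq that by (metis inner_commute inner_diff_right right_minus_eq)
    qed
    then show "y = z" by simp
  qed
qed

lemma dstar_adjoint:
  assumes "x \<in> Vstar W V d j"
  shows "dstar W V d j x \<in> W (j - 1)"
    and "v \<in> V (j - 1) \<Longrightarrow> d (j - 1) v \<bullet> x = v \<bullet> dstar W V d j x"
proof -
  obtain z where z: "x \<in> W j" "z \<in> W (j - 1)" "\<And>v. v \<in> V (j - 1) \<Longrightarrow> d (j - 1) v \<bullet> x = v \<bullet> z"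
    using assms unfolding Vstar_def adjoint_dom_def by blast
  then show "dstar W V d j x \<in> W (j - 1)"
    and "v \<in> V (j - 1) \<Longrightarrow> d (j - 1) v \<bullet> x = v \<bullet> dstar W V d j x"
    using Vstar_dstarI(2)[OF z] by auto
qed

lemma orthogonal_range_Vstar:
  assumes "x \<in> W j" "\<And>v. v \<in> V (j - 1) \<Longrightarrow> d (j - 1) v \<bullet> x = 0"
  shows "x \<in> Vstar W V d j" "dstar W V d j x = 0"
  using Vstar_dstarI[of x j 0] assms subspace_0[OF subspace_W] by auto

lemma compact_subsequence:
  fixes v :: "nat \<Rightarrow> 'a"
  assumes cp: "compactness_property W V d"
    and V: "\<And>n. v n \<in> V j" and orth: "\<And>n w. w \<in> V (j - 1) \<Longrightarrow> d (j - 1) w \<bullet> v n = 0"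
    and bd: "\<And>n. norm (v n) \<le> C" "\<And>n. norm (d j (v n)) \<le> C"
  obtains r :: "nat \<Rightarrow> nat" and z where "strict_mono r" "z \<in> W j" "(v \<circ> r) \<longlonglongrightarrow> z"
proof -
  have star: "v n \<in> Vstar W V d j" "dstar W V d j (v n) = 0" for n
    using orthogonal_range_Vstar[OF in_W[OF V] orth] by blast+
  have "bdd_above (VVstar_norm W V d j ` range v)"
  proof (rule bdd_aboveI)
    fix t assume "t \<in> VVstar_norm W V d j ` range v"
    then obtain n where "t = sqrt ((norm (v n))\<^sup>2 + (norm (d j (v n)))\<^sup>2)"
      by (auto simp: VVstar_norm_def star)
    also have "\<dots> \<le> sqrt (C\<^sup>2 + C\<^sup>2)"
      by (intro real_sqrt_le_mono add_mono power_mono bd norm_ge_zero)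
    finally show "t \<le> sqrt (C\<^sup>2 + C\<^sup>2)" .
  qed
  moreover have "range v \<subseteq> V j \<inter> Vstar W V d j" using V star by blast
  ultimately have "compact (closure ((\<lambda>v. v) ` range v))"
    using cp unfolding compactness_property_def compact_op_def by blast
  then have sc: "seq_compact (closure (range v))" by (simp add: compact_eq_seq_compact_metric)
  have cl: "\<forall>n. v n \<in> closure (range v)"
    using closure_subset[of "range v"] by blast
  obtain z r where r: "strict_mono r" "(v \<circ> r) \<longlonglongrightarrow> z"
    using seq_compactE[OF sc cl] by metis
  moreover have "z \<in> W j"
    by (rule closed_sequentially[OF closed_W _ r(2)]) (simp add: in_W V)
  ultimately show ?thesis using that by blast
qed

lemma orthogonal_kernel_range:
  assumes "\<And>w. w \<in> V j \<Longrightarrow> d j w = 0 \<Longrightarrow> x \<bullet> w = 0" "w \<in> V (j - 1)"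
  shows "d (j - 1) w \<bullet> x = 0"
  using assms(1)[of "d (j - 1) w"] assms(2) by (simp add: d_prev_in_V d_d_prev inner_commute)

lemma poincare_inequality:
  assumes cp: "compactness_property W V d"
  shows "\<exists>C. \<forall>v\<in>V j. (\<forall>w\<in>V j. d j w = 0 \<longrightarrow> v \<bullet> w = 0) \<longrightarrow> norm v \<le> C * norm (d j v)"
proof (rule ccontr)
  assume "\<not> ?thesis"
  then have "\<exists>v\<in>V j. (\<forall>w\<in>V j. d j w = 0 \<longrightarrow> v \<bullet> w = 0) \<and> norm v > real (Suc n) * norm (d j v)" for n
    by (metis not_less)
  then obtain v where v: "\<And>n. v n \<in> V j" "\<And>n w. w \<in> V j \<Longrightarrow> d j w = 0 \<Longrightarrow> v n \<bullet> w = 0"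
    and large: "\<And>n. norm (v n) > real (Suc n) * norm (d j (v n))"
    by metis
  have pos: "norm (v n) > 0" for n
    by (rule le_less_trans[OF _ large]) simp
  define x where "x n = (1 / norm (v n)) *\<^sub>R v n" for n
  have xV: "x n \<in> V j" for n unfolding x_def by (intro subspace_scale subspace_V v)
  have xo: "x n \<bullet> w = 0" if "w \<in> V j" "d j w = 0" for n w using v(2)[OF that] by (simp add: x_def)
  have nx: "norm (x n) = 1" for n using pos[of n] by (simp add: x_def)
  have dx: "norm (d j (x n)) \<le> inverse (real (Suc n))" for n
    using large[of n] pos[of n] by (simp add: x_def d_scale v field_simps)
  have "inverse (real (Suc n)) \<le> 1" for n by (simp add: field_simps)
  then have dx1: "norm (d j (x n)) \<le> 1" for n using dx order_trans by blast
  have d0: "(\<lambda>n. d j (x n)) \<longlonglongrightarrow> 0"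
    by (rule Lim_null_comparison[OF _ LIMSEQ_inverse_real_of_nat]) (intro always_eventually allI dx)
  have xr: "d (j - 1) w \<bullet> x n = 0" if "w \<in> V (j - 1)" for n w
    by (rule orthogonal_kernel_range[OF xo that])
  have nx1: "norm (x n) \<le> 1" for n by (simp add: nx)
  obtain r z where r: "strict_mono r" "(x \<circ> r) \<longlonglongrightarrow> z"
    by (rule compact_subsequence[of x, OF cp xV xr nx1 dx1])
  have lim: "(\<lambda>n. x (r n)) \<longlonglongrightarrow> z" "(\<lambda>n. d j (x (r n))) \<longlonglongrightarrow> 0"
    using r LIMSEQ_subseq_LIMSEQ[OF d0 r(1)] by (auto simp: o_def)
  have z: "z \<in> V j" "d j z = 0" by (rule d_closed[OF xV lim])+
  have "(\<lambda>n. x (r n) \<bullet> z) \<longlonglongrightarrow> z \<bullet> z" by (intro tendsto_intros lim)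
  then have "z \<bullet> z = 0" using xo[OF z] by (simp add: LIMSEQ_const_iff)
  moreover have "(\<lambda>n. norm (x (r n))) \<longlonglongrightarrow> norm z" by (intro tendsto_intros lim)
  then have "norm z = 1" using nx by (simp add: LIMSEQ_const_iff)
  ultimately show False by simp
qed

lemma hodge_splitting:
  assumes u: "u \<in> V j"
  obtains \<rho> where "\<rho> \<in> V (j - 1)" "\<And>w. w \<in> V (j - 1) \<Longrightarrow> d (j - 1) w = 0 \<Longrightarrow> \<rho> \<bullet> w = 0"
    "\<And>w. w \<in> V (j - 1) \<Longrightarrow> d (j - 1) w \<bullet> (u - d (j - 1) \<rho>) = 0"
    "norm (d (j - 1) \<rho>) \<le> norm u"
proof -
  obtain p where p: "p \<in> d (j - 1) ` V (j - 1)"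
    "\<And>s. s \<in> d (j - 1) ` V (j - 1) \<Longrightarrow> (u - p) \<bullet> s = 0"
    using orthogonal_projection_exists[OF subspace_range closed_range] by blast
  then obtain \<rho>0 where \<rho>0: "\<rho>0 \<in> V (j - 1)" "p = d (j - 1) \<rho>0" by blast
  obtain q where q: "q \<in> {v \<in> V (j - 1). d (j - 1) v = 0}"
    "\<And>s. s \<in> {v \<in> V (j - 1). d (j - 1) v = 0} \<Longrightarrow> (\<rho>0 - q) \<bullet> s = 0"
    using orthogonal_projection_exists[OF subspace_kernel closed_kernel] by blast
  have d\<rho>: "d (j - 1) (\<rho>0 - q) = p" using \<rho>0 q(1) by (simp add: d_diff)
  have up: "(u - p) \<bullet> p = 0" using p by blast
  have "(norm p)\<^sup>2 = u \<bullet> p" using up by (simp add: inner_diff_left power2_norm_eq_inner)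
  also have "\<dots> \<le> norm u * norm p" using Cauchy_Schwarz_ineq2[of u p] by linarith
  finally have "norm p \<le> norm u" by (cases "p = 0") (simp_all add: power2_eq_square)
  then show ?thesis
    using that[of "\<rho>0 - q"] \<rho>0(1) q p(2) subspace_diff[OF subspace_V \<rho>0(1)] d\<rho>
    by (auto simp: inner_commute)
qed

end

section \<open>Discrete subcomplexes\<close>

lemma weakly_converges_bounded_op_inner:
  fixes A :: "'b::{real_inner,complete_space} set" and T :: "'b \<Rightarrow> 'c::real_inner"
  assumes A: "subspace A" "closed A" and T: "bounded_op A B T"
    and x: "weakly_converges x z" "\<And>n. x n \<in> A" "z \<in> A" and bd: "\<And>n. norm (x n) \<le> C"
    and y: "y \<longlonglongrightarrow> y0"
  shows "(\<lambda>n. T (x n) \<bullet> y n) \<longlonglongrightarrow> T z \<bullet> y0"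
proof -
  obtain c where c: "\<And>x. x \<in> A \<Longrightarrow> norm (T x) \<le> c * norm x"
    using T unfolding bounded_op_def by blast
  have "norm (T (x n)) \<le> \<bar>c\<bar> * C" for n
  proof -
    have "norm (T (x n)) \<le> c * norm (x n)" by (rule c[OF x(2)])
    also have "\<dots> \<le> \<bar>c\<bar> * C" by (intro mult_mono bd) auto
    finally show ?thesis .
  qed
  then show ?thesis
    by (rule weakly_converges_inner[OF weakly_converges_bounded_op[OF A T x] _ y])
qed

lemma bounded_op_null:
  assumes T: "bounded_op A B T" and x: "\<And>n. x n \<in> A" "x \<longlonglongrightarrow> 0"
  shows "(\<lambda>n. T (x n)) \<longlonglongrightarrow> 0"
proof -
  obtain c where c: "\<And>x. x \<in> A \<Longrightarrow> norm (T x) \<le> c * norm x"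
    using T unfolding bounded_op_def by blast
  have "(\<lambda>n. c * norm (x n)) \<longlonglongrightarrow> c * norm (0::'a)" by (intro tendsto_intros x)
  then have 1: "(\<lambda>n. c * norm (x n)) \<longlonglongrightarrow> 0" by simp
  show ?thesis
    by (rule Lim_null_comparison[OF _ 1]) (intro always_eventually allI c x)
qed

lemma bounded_op_bounded_seq:
  assumes T: "bounded_op A B T" and x: "\<And>n. x n \<in> A" "\<And>n. norm (x n) \<le> C"
  obtains C' where "\<And>n. norm (T (x n)) \<le> C'"
proof -
  obtain c where c: "\<And>x. x \<in> A \<Longrightarrow> norm (T x) \<le> c * norm x"
    using T unfolding bounded_op_def by blast
  have "norm (T (x n)) \<le> \<bar>c\<bar> * C" for n
  proof -
    have "norm (T (x n)) \<le> c * norm (x n)" by (rule c[OF x(1)])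
    also have "\<dots> \<le> \<bar>c\<bar> * C" by (intro mult_mono x) auto
    finally show ?thesis .
  qed
  then show ?thesis by (rule that)
qed

lemma inner_null:
  fixes x y :: "nat \<Rightarrow> 'b::real_inner"
  assumes x: "x \<longlonglongrightarrow> 0" and y: "\<And>n. norm (y n) \<le> C"
  shows "(\<lambda>n. x n \<bullet> y n) \<longlonglongrightarrow> 0"
proof -
  have "(\<lambda>n. norm (x n) * C) \<longlonglongrightarrow> norm (0::'b) * C" by (intro tendsto_intros x)
  then have 1: "(\<lambda>n. norm (x n) * C) \<longlonglongrightarrow> 0" by simp
  have "norm (x n \<bullet> y n) \<le> norm (x n) * C" for n
    using Cauchy_Schwarz_ineq2[of "x n" "y n"] mult_left_mono[OF y[of n] norm_ge_zero[of "x n"]]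
    by simp
  then show ?thesis by (intro Lim_null_comparison[OF _ 1] always_eventually allI)
qed

lemma norm_le_V_norm: "norm v \<le> V_norm d j v" and norm_d_le_V_norm: "norm (d j v) \<le> V_norm d j v"
  unfolding V_norm_def by (auto intro: real_le_rsqrt)

lemma V_norm_le: "V_norm d j v \<le> norm v + norm (d j v)"
  unfolding V_norm_def by (rule sqrt_sum_squares_le_sum) simp_all

locale discrete_hilbert_complex = hilbert_complex_locale W V d
  for W V :: "int \<Rightarrow> 'a::{real_inner,complete_space} set" and d :: "int \<Rightarrow> 'a \<Rightarrow> 'a" +
  fixes Vh :: "real \<Rightarrow> int \<Rightarrow> 'a set" and \<pi> :: "real \<Rightarrow> int \<Rightarrow> 'a \<Rightarrow> 'a"
  assumes subcomplexes: "discrete_subcomplexes V d Vh"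
    and dense: "dense_discrete V d Vh"
    and projections: "bounded_cochain_projections W V d Vh \<pi>"
begin

lemma Vh_finite_span: "h > 0 \<Longrightarrow> \<exists>B. finite B \<and> Vh h j = span B"
  and Vh_subset_V: "h > 0 \<Longrightarrow> Vh h j \<subseteq> V j"
  using subcomplexes unfolding discrete_subcomplexes_def by blast+

lemma Vh_in_V: "h > 0 \<Longrightarrow> v \<in> Vh h j \<Longrightarrow> v \<in> V j"
  using Vh_subset_V by blast

lemma subspace_Vh: "h > 0 \<Longrightarrow> subspace (Vh h j)"
  using Vh_finite_span[of h j] subspace_span by auto

lemma d_in_Vh: "h > 0 \<Longrightarrow> v \<in> Vh h (j - 1) \<Longrightarrow> d (j - 1) v \<in> Vh h j"
  using subcomplexes unfolding discrete_subcomplexes_def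
  by (metis diff_add_cancel image_subset_iff)

lemma projection_linear: "h > 0 \<Longrightarrow> linear_map (W j) (Vh h j) (\<pi> h j)"
  and projection_id: "h > 0 \<Longrightarrow> v \<in> Vh h j \<Longrightarrow> \<pi> h j v = v"
  and projection_bounded: "\<exists>C. \<forall>h>0. \<forall>w\<in>W j. norm (\<pi> h j w) \<le> C * norm w"
  using projections unfolding bounded_cochain_projections_def by blast+

lemma projection_in_Vh: "h > 0 \<Longrightarrow> w \<in> W j \<Longrightarrow> \<pi> h j w \<in> Vh h j"
  using projection_linear unfolding linear_map_def by blast

lemma d_projection: "h > 0 \<Longrightarrow> v \<in> V (j - 1) \<Longrightarrow> d (j - 1) (\<pi> h (j - 1) v) = \<pi> h j (d (j - 1) v)"
  using projections unfolding bounded_cochain_projections_def by (metis diff_add_cancel)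

lemma discrete_approximation:
  fixes h :: "nat \<Rightarrow> real"
  assumes v: "v \<in> V j" and h: "\<And>n. h n > 0" "h \<longlonglongrightarrow> 0"
  obtains t where "\<And>n. t n \<in> Vh (h n) j" "t \<longlonglongrightarrow> v" "(\<lambda>n. d j (t n)) \<longlonglongrightarrow> d j v"
proof -
  define I where "I n = (INF w\<in>Vh (h n) j. V_norm d j (v - w))" for n
  have hh: "filterlim h (at_right 0) sequentially"
    by (rule tendsto_imp_filterlim_at_right) (use h in auto)
  have "((\<lambda>h. INF w\<in>Vh h j. V_norm d j (v - w)) \<longlongrightarrow> 0) (at_right 0)"
    using dense v unfolding dense_discrete_def by blast
  from filterlim_compose[OF this hh] have I: "(\<lambda>n. I n) \<longlonglongrightarrow> 0" unfolding I_def .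
  have "\<exists>w\<in>Vh (h n) j. V_norm d j (v - w) < I n + inverse (real (Suc n))" for n
  proof -
    have "Vh (h n) j \<noteq> {}" using subspace_0[OF subspace_Vh[OF h(1)]] by blast
    moreover have "bdd_below ((\<lambda>w. V_norm d j (v - w)) ` Vh (h n) j)"
      by (rule bdd_belowI[of _ 0]) (auto simp: V_norm_def)
    ultimately show ?thesis
      using cINF_less_iff[of "Vh (h n) j" "\<lambda>w. V_norm d j (v - w)" "I n + inverse (real (Suc n))"]
      unfolding I_def by simp
  qed
  then obtain t where t: "\<And>n. t n \<in> Vh (h n) j"
    and near: "\<And>n. V_norm d j (v - t n) < I n + inverse (real (Suc n))"
    by metis
  have lim: "(\<lambda>n. I n + inverse (real (Suc n))) \<longlonglongrightarrow> 0"
    using tendsto_add[OF I LIMSEQ_inverse_real_of_nat] by simp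
  have tV: "t n \<in> V j" for n using Vh_in_V[OF h(1) t] .
  have bt: "norm (t n - v) \<le> I n + inverse (real (Suc n))" for n
    using norm_le_V_norm[of "v - t n" d j] near[of n] by (simp add: norm_minus_commute)
  have bd: "norm (d j (t n) - d j v) \<le> I n + inverse (real (Suc n))" for n
    using norm_d_le_V_norm[of d j "v - t n"] near[of n] d_diff[OF v tV, of n]
    by (simp add: norm_minus_commute)
  have "(\<lambda>n. t n - v) \<longlonglongrightarrow> 0"
    by (rule Lim_null_comparison[OF _ lim]) (intro always_eventually allI bt)
  moreover have "(\<lambda>n. d j (t n) - d j v) \<longlonglongrightarrow> 0"
    by (rule Lim_null_comparison[OF _ lim]) (intro always_eventually allI bd)
  ultimately show ?thesis using that[of t] t by (simp add: LIM_zero_iff)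
qed

lemma projection_converges:
  fixes h :: "nat \<Rightarrow> real"
  assumes h: "\<And>n. h n > 0" "h \<longlonglongrightarrow> 0"
    and x: "\<And>n. x n \<in> W j" "x \<longlonglongrightarrow> x0" "x0 \<in> W j"
  shows "(\<lambda>n. \<pi> (h n) j (x n)) \<longlonglongrightarrow> x0"
proof -
  obtain C0 where C0: "\<And>h w. h > 0 \<Longrightarrow> w \<in> W j \<Longrightarrow> norm (\<pi> h j w) \<le> C0 * norm w"
    using projection_bounded by blast
  define C where "C = \<bar>C0\<bar>"
  have C: "norm (\<pi> h j w) \<le> C * norm w" if "h > 0" "w \<in> W j" for h w
  proof -
    have "C0 * norm w \<le> C * norm w" unfolding C_def by (rule mult_right_mono) auto
    then show ?thesis using C0[OF that] by linarith
  qed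
  have Cpos: "C \<ge> 0" by (simp add: C_def)
  show ?thesis
    unfolding tendsto_iff
  proof (intro allI impI)
    fix e :: real assume e: "e > 0"
    have "x0 \<in> closure (V j)" using x(3) dense_V by blast
    moreover have "e / (C + 1) > 0" using e Cpos by simp
    ultimately obtain v where v: "v \<in> V j" "dist v x0 < e / (C + 1)"
      unfolding closure_approachable by blast
    obtain t where t: "\<And>n. t n \<in> Vh (h n) j" "t \<longlonglongrightarrow> v"
      using discrete_approximation[OF v(1) h] by metis
    have tW: "t n \<in> W j" for n by (intro in_W Vh_in_V[OF h(1) t(1)])
    have "(\<lambda>n. C * norm (x n - t n) + norm (t n - x0)) \<longlonglongrightarrow> C * norm (x0 - v) + norm (v - x0)"
      by (intro tendsto_intros x t)
    moreover have "C * norm (x0 - v) + norm (v - x0) < e"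
      using v(2) Cpos by (simp add: dist_norm norm_minus_commute field_simps)
    ultimately have ev: "\<forall>\<^sub>F n in sequentially. C * norm (x n - t n) + norm (t n - x0) < e"
      by (rule order_tendstoD(2))
    have le: "dist (\<pi> (h n) j (x n)) x0 \<le> C * norm (x n - t n) + norm (t n - x0)" for n
    proof -
      have "\<pi> (h n) j (x n - t n) = \<pi> (h n) j (x n) - t n"
        using linear_map_diff[OF projection_linear[OF h(1)] subspace_W x(1) tW]
        by (simp add: projection_id[OF h(1) t(1)])
      then have "\<pi> (h n) j (x n) - x0 = \<pi> (h n) j (x n - t n) + (t n - x0)" by simp
      then have "norm (\<pi> (h n) j (x n) - x0) \<le> norm (\<pi> (h n) j (x n - t n)) + norm (t n - x0)"
        by (metis norm_triangle_ineq)
      also have "norm (\<pi> (h n) j (x n - t n)) \<le> C * norm (x n - t n)"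
        by (intro C h subspace_diff subspace_W x tW)
      finally show ?thesis by (simp add: dist_norm)
    qed
    show "\<forall>\<^sub>F n in sequentially. dist (\<pi> (h n) j (x n)) x0 < e"
      by (rule eventually_mono[OF ev]) (rule le_less_trans[OF le])
  qed
qed

end

section \<open>The mixed problem\<close>

locale mixed_problem = discrete_hilbert_complex W V d Vh \<pi>
  for W V :: "int \<Rightarrow> 'a::{real_inner,complete_space} set" and d :: "int \<Rightarrow> 'a \<Rightarrow> 'a"
    and Vh :: "real \<Rightarrow> int \<Rightarrow> 'a set" and \<pi> :: "real \<Rightarrow> int \<Rightarrow> 'a \<Rightarrow> 'a" +
  fixes k :: int and l1 l2 l3 l4 l5 :: "'a \<Rightarrow> 'a"
  assumes compactness: "compactness_property W V d"
    and l1: "bounded_op (W k) (W (k + 1)) l1"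
    and l2: "bounded_op (W k) (W (k - 1)) l2"
    and l3: "bounded_op (W (k - 1)) (W k) l3"
    and l4: "bounded_op (W (k + 1)) (W k) l4"
    and l5: "bounded_op (W k) (W k) l5"
    and L_injective: "\<And>u. u \<in> V k \<inter> Vstar W V d k \<Longrightarrow>
      (\<And>v. v \<in> V k \<inter> Vstar W V d k \<Longrightarrow>
        lower_order_operator W V d k l1 l2 l3 l4 l5 u v = 0) \<Longrightarrow> u = 0"
begin

abbreviation galerkin :: "real \<Rightarrow> 'a \<Rightarrow> 'a \<Rightarrow> 'a \<Rightarrow> bool" where
  "galerkin h \<equiv> mixed_galerkin_solution d k l1 l2 l3 l4 l5 (Vh h (k - 1)) (Vh h k)"

lemma l1_linear: "linear_map (W k) (W (k + 1)) l1"
  and l2_linear: "linear_map (W k) (W (k - 1)) l2"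
  and l3_linear: "linear_map (W (k - 1)) (W k) l3"
  and l4_linear: "linear_map (W (k + 1)) (W k) l4"
  and l5_linear: "linear_map (W k) (W k) l5"
  using l1 l2 l3 l4 l5 unfolding bounded_op_def by blast+

lemma galerkinD:
  assumes "h > 0" "galerkin h f \<sigma> u"
  shows "\<sigma> \<in> V (k - 1)" "u \<in> V k" "\<sigma> \<in> Vh h (k - 1)" "u \<in> Vh h k"
    and "\<And>\<tau>. \<tau> \<in> Vh h (k - 1) \<Longrightarrow> \<sigma> \<bullet> \<tau> - u \<bullet> d (k - 1) \<tau> - l2 u \<bullet> \<tau> = 0"
    and "\<And>v. v \<in> Vh h k \<Longrightarrow> d (k - 1) \<sigma> \<bullet> v + l3 \<sigma> \<bullet> v + d k u \<bullet> d k v + l1 u \<bullet> d k v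
      + l4 (d k u) \<bullet> v + l5 u \<bullet> v = f \<bullet> v"
  using assms Vh_in_V[OF assms(1)] unfolding mixed_galerkin_solution_def
  by (auto simp: inner_add_left add.assoc)

lemma l3_adjoint:
  assumes "\<sigma> \<in> W (k - 1)"
  shows "\<sigma> \<bullet> adjoint_op (W (k - 1)) (W (k - 1)) l3 v = l3 \<sigma> \<bullet> v"
proof -
  let ?W = "W (k - 1)"
  obtain z where z: "z \<in> ?W" "\<And>x. x \<in> ?W \<Longrightarrow> l3 x \<bullet> v = x \<bullet> z"
    using bounded_op_adjoint[OF subspace_W closed_W l3] by blast
  have "adjoint_op ?W ?W l3 v = z"
    unfolding adjoint_op_def
  proof (rule the_equality)
    show "z \<in> ?W \<and> (\<forall>x\<in>?W. l3 x \<bullet> v = x \<bullet> z)" using z by blast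
    fix y assume y: "y \<in> ?W \<and> (\<forall>x\<in>?W. l3 x \<bullet> v = x \<bullet> y)"
    then have "y - z \<in> ?W" using z subspace_W by (simp add: subspace_diff)
    then have "(y - z) \<bullet> y = (y - z) \<bullet> z" using y z(2) by metis
    then have "(y - z) \<bullet> (y - z) = 0" by (simp only: inner_diff_right)
    then show "y = z" by simp
  qed
  then show ?thesis using z(2)[OF assms] by simp
qed

lemma homogeneous_mixed_solution:
  assumes \<sigma>: "\<sigma> \<in> V (k - 1)" and u: "u \<in> V k"
    and eq1: "\<And>\<tau>. \<tau> \<in> V (k - 1) \<Longrightarrow> \<sigma> \<bullet> \<tau> - u \<bullet> d (k - 1) \<tau> - l2 u \<bullet> \<tau> = 0"
    and eq2: "\<And>v. v \<in> V k \<Longrightarrow> d (k - 1) \<sigma> \<bullet> v + l3 \<sigma> \<bullet> v + d k u \<bullet> d k v + l1 u \<bullet> d k v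
      + l4 (d k u) \<bullet> v + l5 u \<bullet> v = 0"
  shows "u = 0" "\<sigma> = 0"
proof -
  have l2W: "l2 u \<in> W (k - 1)" using l2_linear in_W[OF u] by (simp add: linear_map_def)
  have sW: "\<sigma> - l2 u \<in> W (k - 1)" by (intro subspace_diff subspace_W in_W \<sigma> l2W)
  have "d (k - 1) \<tau> \<bullet> u = \<tau> \<bullet> (\<sigma> - l2 u)" if "\<tau> \<in> V (k - 1)" for \<tau>
    using eq1[OF that] by (simp add: inner_diff_right inner_commute)
  note star = Vstar_dstarI[OF in_W[OF u] sW this]
  show u0: "u = 0"
  proof (rule L_injective)
    show "u \<in> V k \<inter> Vstar W V d k" using u star by blast
    fix v assume v: "v \<in> V k \<inter> Vstar W V d k"
    have "\<sigma> \<bullet> dstar W V d k v = d (k - 1) \<sigma> \<bullet> v"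
      using dstar_adjoint(2)[of v k \<sigma>] v \<sigma> by simp
    then show "lower_order_operator W V d k l1 l2 l3 l4 l5 u v = 0"
      using eq2[of v] v l3_adjoint[OF in_W[OF \<sigma>], of v]
      by (simp add: lower_order_operator_def star(2) inner_add_left inner_add_right)
  qed
  have "l2 0 = 0" by (rule linear_map_0[OF l2_linear subspace_0[OF subspace_W]])
  then have "\<sigma> \<bullet> \<tau> = 0" if "\<tau> \<in> V (k - 1)" for \<tau> using eq1[OF that] by (simp add: u0)
  then show "\<sigma> = 0" by (rule eq_0_if_orthogonal_V[OF in_W[OF \<sigma>]])
qed

context
  fixes h :: "nat \<Rightarrow> real" and f \<sigma> u :: "nat \<Rightarrow> 'a" and C :: real
  assumes h: "\<And>n. h n > 0" "h \<longlonglongrightarrow> 0"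
    and sol: "\<And>n. galerkin (h n) (f n) (\<sigma> n) (u n)"
    and bounds: "\<And>n. norm (\<sigma> n) \<le> C" "\<And>n. norm (d (k - 1) (\<sigma> n)) \<le> C"
      "\<And>n. norm (u n) \<le> C" "\<And>n. norm (d k (u n)) \<le> C"
    and f_null: "f \<longlonglongrightarrow> 0"
begin

lemma seq_in_V: "\<sigma> n \<in> V (k - 1)" "u n \<in> V k"
  using galerkinD(1,2)[OF h(1) sol] .

lemma seq_in_W: "\<sigma> n \<in> W (k - 1)" "u n \<in> W k" "d k (u n) \<in> W (k + 1)"
  by (intro in_W seq_in_V d_in_V)+

text \<open>The weak limit solves the homogeneous continuous problem.\<close>

lemma weakly_null_subsequence:
  obtains r :: "nat \<Rightarrow> nat" where "strict_mono r"
    "weakly_converges (\<sigma> \<circ> r) 0" "weakly_converges (u \<circ> r) 0"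
proof -
  let ?G = "\<lambda>j. {(v, d j v) | v. v \<in> V j}"
  define x where "x n = ((\<sigma> n, d (k - 1) (\<sigma> n)), (u n, d k (u n)))" for n
  have G: "subspace (?G (k - 1) \<times> ?G k)" "closed (?G (k - 1) \<times> ?G k)"
    by (intro subspace_Times subspace_graph closed_Times closed_graph)+
  have xG: "x n \<in> ?G (k - 1) \<times> ?G k" for n using seq_in_V by (auto simp: x_def)
  have nx: "norm (x n) \<le> 4 * C" for n
  proof -
    have "norm (x n) \<le> norm (\<sigma> n, d (k - 1) (\<sigma> n)) + norm (u n, d k (u n))"
      unfolding x_def by (rule norm_Pair_le)
    also have "\<dots> \<le> (norm (\<sigma> n) + norm (d (k - 1) (\<sigma> n))) + (norm (u n) + norm (d k (u n)))"
      by (intro add_mono norm_Pair_le)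
    also have "\<dots> \<le> 4 * C" using bounds[of n] by linarith
    finally show ?thesis .
  qed
  obtain r z where r: "strict_mono r" and z: "z \<in> ?G (k - 1) \<times> ?G k"
    and wx: "weakly_converges (x \<circ> r) z"
    by (rule weakly_convergent_subsequence[OF G xG nx])
  obtain s w where zsw: "z = ((s, d (k - 1) s), (w, d k w))" and s: "s \<in> V (k - 1)" and w: "w \<in> V k"
    using z by auto
  have lim: "(\<lambda>n. \<sigma> (r n) \<bullet> a + d (k - 1) (\<sigma> (r n)) \<bullet> b + (u (r n) \<bullet> c + d k (u (r n)) \<bullet> e))
      \<longlonglongrightarrow> s \<bullet> a + d (k - 1) s \<bullet> b + (w \<bullet> c + d k w \<bullet> e)" for a b c e
    using wx unfolding weakly_converges_def
    by (auto simp: x_def zsw inner_Pair dest: spec[of _ "((a, b), (c, e))"])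
  have weak: "weakly_converges (\<lambda>n. \<sigma> (r n)) s" "weakly_converges (\<lambda>n. d (k - 1) (\<sigma> (r n))) (d (k - 1) s)"
    "weakly_converges (\<lambda>n. u (r n)) w" "weakly_converges (\<lambda>n. d k (u (r n))) (d k w)"
    unfolding weakly_converges_def
    using lim[of _ 0 0 0] lim[of 0 _ 0 0] lim[of 0 0 _ 0] lim[of 0 0 0] by simp_all
  have hr: "h (r n) > 0" "(\<lambda>n. h (r n)) \<longlonglongrightarrow> 0" for n
    using h LIMSEQ_subseq_LIMSEQ[OF h(2) r] by (auto simp: o_def)
  have fr: "(\<lambda>n. f (r n)) \<longlonglongrightarrow> 0"
    using LIMSEQ_subseq_LIMSEQ[OF f_null r] by (simp add: o_def)
  note W = subspace_W closed_W
  note op = weakly_converges_bounded_op_inner[OF W]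
  have eq1: "s \<bullet> \<tau> - w \<bullet> d (k - 1) \<tau> - l2 w \<bullet> \<tau> = 0" if \<tau>: "\<tau> \<in> V (k - 1)" for \<tau>
  proof -
    obtain t where t: "\<And>n. t n \<in> Vh (h (r n)) (k - 1)" "t \<longlonglongrightarrow> \<tau>"
      "(\<lambda>n. d (k - 1) (t n)) \<longlonglongrightarrow> d (k - 1) \<tau>"
      using discrete_approximation[OF \<tau> hr] by metis
    have "(\<lambda>n. \<sigma> (r n) \<bullet> t n - u (r n) \<bullet> d (k - 1) (t n) - l2 (u (r n)) \<bullet> t n)
        \<longlonglongrightarrow> s \<bullet> \<tau> - w \<bullet> d (k - 1) \<tau> - l2 w \<bullet> \<tau>"
      by (intro tendsto_diff weakly_converges_inner[OF weak(1) bounds(1) t(2)]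
          weakly_converges_inner[OF weak(3) bounds(3) t(3)]
          op[OF l2 weak(3) seq_in_W(2) in_W[OF w] bounds(3) t(2)])
    moreover have "\<sigma> (r n) \<bullet> t n - u (r n) \<bullet> d (k - 1) (t n) - l2 (u (r n)) \<bullet> t n = 0" for n
      by (rule galerkinD(5)[OF h(1) sol t(1)])
    ultimately show ?thesis by (simp add: LIMSEQ_const_iff)
  qed
  have eq2: "d (k - 1) s \<bullet> v + l3 s \<bullet> v + d k w \<bullet> d k v + l1 w \<bullet> d k v
      + l4 (d k w) \<bullet> v + l5 w \<bullet> v = 0" if v: "v \<in> V k" for v
  proof -
    obtain t where t: "\<And>n. t n \<in> Vh (h (r n)) k" "t \<longlonglongrightarrow> v" "(\<lambda>n. d k (t n)) \<longlonglongrightarrow> d k v"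
      using discrete_approximation[OF v hr] by metis
    have "(\<lambda>n. d (k - 1) (\<sigma> (r n)) \<bullet> t n + l3 (\<sigma> (r n)) \<bullet> t n + d k (u (r n)) \<bullet> d k (t n)
        + l1 (u (r n)) \<bullet> d k (t n) + l4 (d k (u (r n))) \<bullet> t n + l5 (u (r n)) \<bullet> t n)
        \<longlonglongrightarrow> d (k - 1) s \<bullet> v + l3 s \<bullet> v + d k w \<bullet> d k v + l1 w \<bullet> d k v
      + l4 (d k w) \<bullet> v + l5 w \<bullet> v"
      by (intro tendsto_add weakly_converges_inner[OF weak(2) bounds(2) t(2)]
          weakly_converges_inner[OF weak(4) bounds(4) t(3)]
          op[OF l3 weak(1) seq_in_W(1) in_W[OF s] bounds(1) t(2)]
          op[OF l1 weak(3) seq_in_W(2) in_W[OF w] bounds(3) t(3)]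
          op[OF l4 weak(4) seq_in_W(3) in_W[OF d_in_V[OF w]] bounds(4) t(2)]
          op[OF l5 weak(3) seq_in_W(2) in_W[OF w] bounds(3) t(2)])
    moreover have "d (k - 1) (\<sigma> (r n)) \<bullet> t n + l3 (\<sigma> (r n)) \<bullet> t n + d k (u (r n)) \<bullet> d k (t n)
        + l1 (u (r n)) \<bullet> d k (t n) + l4 (d k (u (r n))) \<bullet> t n + l5 (u (r n)) \<bullet> t n = f (r n) \<bullet> t n" for n
      by (rule galerkinD(6)[OF h(1) sol t(1)])
    moreover have "(\<lambda>n. f (r n) \<bullet> t n) \<longlonglongrightarrow> 0 \<bullet> v" by (intro tendsto_inner fr t)
    ultimately show ?thesis using LIMSEQ_unique by (simp only: inner_zero_left)
  qed
  have "w = 0" "s = 0" by (rule homogeneous_mixed_solution[OF s w eq1 eq2]; assumption)+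
  then show ?thesis using that[OF r] weak by (simp add: o_def)
qed

text \<open>Discrete compactness: write \<open>u = d \<rho> + \<theta>\<close> with \<open>\<rho>\<close> orthogonal to the kernel and \<open>\<theta>\<close> to the
  range of \<open>d\<close>. Both components are precompact in \<open>W\<close>, and the first Galerkin equation gives
  \<open>\<parallel>u\<parallel>\<^sup>2 = (u, \<pi> u) = (\<sigma> - l2 u, \<pi> \<rho>) + (u, \<pi> \<theta>)\<close>.\<close>

lemma strongly_null_subsequence:
  assumes weak: "weakly_converges \<sigma> 0" "weakly_converges u 0"
  obtains r :: "nat \<Rightarrow> nat" where "strict_mono r" "(u \<circ> r) \<longlonglongrightarrow> 0"
proof -
  have C0: "0 \<le> C" using bounds(1)[of 0] norm_ge_zero order_trans by blast
  have "\<exists>\<rho>. \<rho> \<in> V (k - 1) \<and> (\<forall>w\<in>V (k - 1). d (k - 1) w = 0 \<longrightarrow> \<rho> \<bullet> w = 0) \<and>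
      (\<forall>w\<in>V (k - 1). d (k - 1) w \<bullet> (u n - d (k - 1) \<rho>) = 0) \<and> norm (d (k - 1) \<rho>) \<le> norm (u n)" for n
    by (rule hodge_splitting[OF seq_in_V(2)[of n]]) blast
  then obtain \<rho> where \<rho>V: "\<And>n. \<rho> n \<in> V (k - 1)"
    and \<rho>o: "\<And>n w. w \<in> V (k - 1) \<Longrightarrow> d (k - 1) w = 0 \<Longrightarrow> \<rho> n \<bullet> w = 0"
    and \<theta>o: "\<And>n w. w \<in> V (k - 1) \<Longrightarrow> d (k - 1) w \<bullet> (u n - d (k - 1) (\<rho> n)) = 0"
    and d\<rho>: "\<And>n. norm (d (k - 1) (\<rho> n)) \<le> norm (u n)"
    by metis
  define \<theta> where "\<theta> n = u n - d (k - 1) (\<rho> n)" for n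
  have d\<rho>C: "norm (d (k - 1) (\<rho> n)) \<le> C" for n using d\<rho> bounds(3) order_trans by blast
  obtain P where P: "\<And>v. v \<in> V (k - 1) \<Longrightarrow> (\<And>w. w \<in> V (k - 1) \<Longrightarrow> d (k - 1) w = 0 \<Longrightarrow> v \<bullet> w = 0)
      \<Longrightarrow> norm v \<le> P * norm (d (k - 1) v)"
    using poincare_inequality[OF compactness, of "k - 1"] by blast
  have \<rho>C: "norm (\<rho> n) \<le> \<bar>P\<bar> * C" for n
  proof -
    have "norm (\<rho> n) \<le> P * norm (d (k - 1) (\<rho> n))" by (rule P[OF \<rho>V \<rho>o])
    also have "\<dots> \<le> \<bar>P\<bar> * C" by (intro mult_mono d\<rho>C) auto
    finally show ?thesis .
  qed
  let ?D = "max (\<bar>P\<bar> * C) (2 * C)"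
  have \<rho>D: "norm (\<rho> n) \<le> ?D" "norm (d (k - 1) (\<rho> n)) \<le> ?D" for n
    using \<rho>C[of n] d\<rho>C[of n] C0 by (auto simp: le_max_iff_disj)
  have \<rho>r: "d (k - 1 - 1) w \<bullet> \<rho> n = 0" if "w \<in> V (k - 1 - 1)" for n w
    by (rule orthogonal_kernel_range[OF \<rho>o that])
  obtain r1 :: "nat \<Rightarrow> nat" and \<rho>0 where r1: "strict_mono r1" and \<rho>0: "\<rho>0 \<in> W (k - 1)" "(\<rho> \<circ> r1) \<longlonglongrightarrow> \<rho>0"
    by (rule compact_subsequence[of \<rho>, OF compactness \<rho>V \<rho>r \<rho>D])
  have \<theta>V: "\<theta> n \<in> V k" for n
    unfolding \<theta>_def by (intro subspace_diff subspace_V seq_in_V d_prev_in_V \<rho>V)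
  have "d k (\<theta> n) = d k (u n)" for n
    unfolding \<theta>_def by (simp add: d_diff[OF seq_in_V(2) d_prev_in_V[OF \<rho>V]] d_d_prev[OF \<rho>V])
  then have \<theta>D: "norm (\<theta> n) \<le> 2 * C" "norm (d k (\<theta> n)) \<le> 2 * C" for n
    using norm_triangle_ineq4[of "u n" "d (k - 1) (\<rho> n)"] d\<rho>C[of n] bounds(3,4)[of n] C0
    by (auto simp: \<theta>_def)
  obtain r2 :: "nat \<Rightarrow> nat" and \<theta>0 where r2: "strict_mono r2" and \<theta>0: "\<theta>0 \<in> W k" "((\<lambda>n. \<theta> (r1 n)) \<circ> r2) \<longlonglongrightarrow> \<theta>0"
    by (rule compact_subsequence[of "\<lambda>n. \<theta> (r1 n)", OF compactness \<theta>V \<theta>o[folded \<theta>_def] \<theta>D])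
  define r where "r n = r1 (r2 n)" for n
  have r: "strict_mono r" using strict_mono_o[OF r1 r2] by (simp add: r_def[abs_def] o_def)
  have \<rho>lim: "(\<lambda>n. \<rho> (r n)) \<longlonglongrightarrow> \<rho>0"
    using LIMSEQ_subseq_LIMSEQ[OF \<rho>0(2) r2] by (simp add: o_def r_def)
  have \<theta>lim: "(\<lambda>n. \<theta> (r n)) \<longlonglongrightarrow> \<theta>0" using \<theta>0(2) by (simp add: o_def r_def)
  have hr: "h (r n) > 0" "(\<lambda>n. h (r n)) \<longlonglongrightarrow> 0" for n
    using h LIMSEQ_subseq_LIMSEQ[OF h(2) r] by (auto simp: o_def)
  define a b where "a n = \<pi> (h (r n)) (k - 1) (\<rho> (r n))" and "b n = \<pi> (h (r n)) k (\<theta> (r n))" for n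
  have a: "a \<longlonglongrightarrow> \<rho>0"
    unfolding a_def by (rule projection_converges[OF hr in_W[OF \<rho>V] \<rho>lim \<rho>0(1)])
  have b: "b \<longlonglongrightarrow> \<theta>0"
    unfolding b_def by (rule projection_converges[OF hr in_W[OF \<theta>V] \<theta>lim \<theta>0(1)])
  have weakr: "weakly_converges (\<lambda>n. \<sigma> (r n)) 0" "weakly_converges (\<lambda>n. u (r n)) 0"
    using weakly_converges_subseq[OF weak(1) r] weakly_converges_subseq[OF weak(2) r]
    by (simp_all add: o_def)
  have split: "u (r n) \<bullet> u (r n) = \<sigma> (r n) \<bullet> a n - l2 (u (r n)) \<bullet> a n + u (r n) \<bullet> b n" for n
  proof -
    have "u (r n) = \<pi> (h (r n)) k (u (r n))"
      by (rule projection_id[OF h(1) galerkinD(4)[OF h(1) sol], symmetric])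
    also have "\<dots> = \<pi> (h (r n)) k (d (k - 1) (\<rho> (r n)) + \<theta> (r n))" by (simp add: \<theta>_def)
    also have "\<dots> = \<pi> (h (r n)) k (d (k - 1) (\<rho> (r n))) + b n"
      unfolding b_def
      by (intro linear_map_add[OF projection_linear[OF h(1)]] in_W d_prev_in_V \<rho>V \<theta>V)
    also have "\<dots> = d (k - 1) (a n) + b n" by (simp add: a_def d_projection[OF h(1) \<rho>V])
    finally have eq: "u (r n) = d (k - 1) (a n) + b n" .
    have "a n \<in> Vh (h (r n)) (k - 1)"
      unfolding a_def by (rule projection_in_Vh[OF h(1) in_W[OF \<rho>V]])
    from galerkinD(5)[OF h(1) sol this]
    have "u (r n) \<bullet> d (k - 1) (a n) = \<sigma> (r n) \<bullet> a n - l2 (u (r n)) \<bullet> a n" by simp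
    then have "u (r n) \<bullet> (d (k - 1) (a n) + b n) = \<sigma> (r n) \<bullet> a n - l2 (u (r n)) \<bullet> a n + u (r n) \<bullet> b n"
      by (simp only: inner_add_right)
    then show ?thesis using eq by simp
  qed
  have "(\<lambda>n. \<sigma> (r n) \<bullet> a n - l2 (u (r n)) \<bullet> a n + u (r n) \<bullet> b n) \<longlonglongrightarrow> 0 \<bullet> \<rho>0 - l2 0 \<bullet> \<rho>0 + 0 \<bullet> \<theta>0"
    by (intro tendsto_add tendsto_diff weakly_converges_inner[OF weakr(1) bounds(1) a]
        weakly_converges_inner[OF weakr(2) bounds(3) b]
        weakly_converges_bounded_op_inner[OF subspace_W closed_W l2 weakr(2) seq_in_W(2)
          subspace_0[OF subspace_W] bounds(3) a])
  then have "(\<lambda>n. u (r n) \<bullet> u (r n)) \<longlonglongrightarrow> 0"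
    by (simp add: split[symmetric] linear_map_0[OF l2_linear subspace_0[OF subspace_W]])
  then have "(\<lambda>n. sqrt (u (r n) \<bullet> u (r n))) \<longlonglongrightarrow> sqrt 0" by (rule tendsto_real_sqrt)
  then have "(\<lambda>n. norm (u (r n))) \<longlonglongrightarrow> 0" by (simp add: norm_eq_sqrt_inner)
  then show ?thesis using that[OF r] by (simp add: tendsto_norm_zero_iff o_def)
qed

text \<open>Energy estimate: test with \<open>(\<sigma>, u)\<close>, where the terms \<open>(u, d \<sigma>)\<close> cancel, then with \<open>(0, d \<sigma>)\<close>.\<close>

lemma energy_null:
  assumes u: "u \<longlonglongrightarrow> 0"
  shows "\<sigma> \<longlonglongrightarrow> 0" "(\<lambda>n. d k (u n)) \<longlonglongrightarrow> 0" "(\<lambda>n. d (k - 1) (\<sigma> n)) \<longlonglongrightarrow> 0"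
proof -
  have square: "x \<longlonglongrightarrow> 0" if "(\<lambda>n. x n \<bullet> x n) \<longlonglongrightarrow> 0" for x :: "nat \<Rightarrow> 'a"
  proof -
    have "(\<lambda>n. sqrt (x n \<bullet> x n)) \<longlonglongrightarrow> sqrt 0" using that by (rule tendsto_real_sqrt)
    then show ?thesis by (simp add: norm_eq_sqrt_inner[symmetric] tendsto_norm_zero_iff)
  qed
  obtain C3 where C3: "\<And>n. norm (l3 (\<sigma> n)) \<le> C3"
    using bounded_op_bounded_seq[OF l3 seq_in_W(1) bounds(1)] by metis
  obtain C4 where C4: "\<And>n. norm (l4 (d k (u n))) \<le> C4"
    using bounded_op_bounded_seq[OF l4 seq_in_W(3) bounds(4)] by metis
  note null1 = bounded_op_null[OF l1 seq_in_W(2) u] and null2 = bounded_op_null[OF l2 seq_in_W(2) u]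
    and null5 = bounded_op_null[OF l5 seq_in_W(2) u]
  let ?e = "\<lambda>n. f n \<bullet> u n + l2 (u n) \<bullet> \<sigma> n - u n \<bullet> l3 (\<sigma> n) - l1 (u n) \<bullet> d k (u n)
    - u n \<bullet> l4 (d k (u n)) - l5 (u n) \<bullet> u n"
  have energy: "\<sigma> n \<bullet> \<sigma> n + d k (u n) \<bullet> d k (u n) = ?e n" for n
    using galerkinD(5)[OF h(1) sol galerkinD(3)[OF h(1) sol[of n]]]
      galerkinD(6)[OF h(1) sol galerkinD(4)[OF h(1) sol[of n]]]
    by (simp add: inner_commute)
  have "?e \<longlonglongrightarrow> 0 + 0 - 0 - 0 - 0 - 0"
    by (intro tendsto_add tendsto_diff inner_null[OF f_null bounds(3)] inner_null[OF null2 bounds(1)]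
        inner_null[OF u C3] inner_null[OF null1 bounds(4)] inner_null[OF u C4]
        inner_null[OF null5 bounds(3)])
  then have e0: "?e \<longlonglongrightarrow> 0" by simp
  have le: "norm (\<sigma> n \<bullet> \<sigma> n) \<le> ?e n" "norm (d k (u n) \<bullet> d k (u n)) \<le> ?e n" for n
    unfolding energy[symmetric] by simp_all
  show \<sigma>0: "\<sigma> \<longlonglongrightarrow> 0" and du0: "(\<lambda>n. d k (u n)) \<longlonglongrightarrow> 0"
    by (intro square Lim_null_comparison[OF _ e0] always_eventually allI le)+
  note null3 = bounded_op_null[OF l3 seq_in_W(1) \<sigma>0] and null4 = bounded_op_null[OF l4 seq_in_W(3) du0]
  have "d (k - 1) (\<sigma> n) \<bullet> d (k - 1) (\<sigma> n) = f n \<bullet> d (k - 1) (\<sigma> n) - l3 (\<sigma> n) \<bullet> d (k - 1) (\<sigma> n)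
      - l4 (d k (u n)) \<bullet> d (k - 1) (\<sigma> n) - l5 (u n) \<bullet> d (k - 1) (\<sigma> n)" for n
    using galerkinD(6)[OF h(1) sol d_in_Vh[OF h(1) galerkinD(3)[OF h(1) sol[of n]]]]
    by (simp add: d_d_prev[OF seq_in_V(1)])
  moreover have "(\<lambda>n. f n \<bullet> d (k - 1) (\<sigma> n) - l3 (\<sigma> n) \<bullet> d (k - 1) (\<sigma> n)
      - l4 (d k (u n)) \<bullet> d (k - 1) (\<sigma> n) - l5 (u n) \<bullet> d (k - 1) (\<sigma> n)) \<longlonglongrightarrow> 0 - 0 - 0 - 0"
    by (intro tendsto_diff inner_null[OF f_null bounds(2)] inner_null[OF null3 bounds(2)]
        inner_null[OF null4 bounds(2)] inner_null[OF null5 bounds(2)])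
  ultimately show "(\<lambda>n. d (k - 1) (\<sigma> n)) \<longlonglongrightarrow> 0" by (intro square) simp
qed

end

lemma normalized_galerkin_not_null:
  fixes h :: "nat \<Rightarrow> real" and f \<sigma> u :: "nat \<Rightarrow> 'a"
  assumes h: "\<And>n. h n > 0" "h \<longlonglongrightarrow> 0"
    and sol: "\<And>n. galerkin (h n) (f n) (\<sigma> n) (u n)"
    and f: "f \<longlonglongrightarrow> 0"
    and unit: "\<And>n. V_norm d (k - 1) (\<sigma> n) + V_norm d k (u n) = 1"
  shows False
proof -
  have pos: "V_norm d j v \<ge> 0" for j v by (simp add: V_norm_def)
  have bounds: "norm (\<sigma> n) \<le> 1" "norm (d (k - 1) (\<sigma> n)) \<le> 1" "norm (u n) \<le> 1" "norm (d k (u n)) \<le> 1" for n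
    using unit[of n] pos[of "k - 1" "\<sigma> n"] pos[of k "u n"]
      norm_le_V_norm[of "\<sigma> n" d "k - 1"] norm_d_le_V_norm[of d "k - 1" "\<sigma> n"]
      norm_le_V_norm[of "u n" d k] norm_d_le_V_norm[of d k "u n"] by linarith+
  obtain r1 :: "nat \<Rightarrow> nat" where r1: "strict_mono r1" "weakly_converges (\<sigma> \<circ> r1) 0" "weakly_converges (u \<circ> r1) 0"
    by (rule weakly_null_subsequence[of h f \<sigma> u 1, OF h sol bounds f])
  have h1: "(h \<circ> r1) n > 0" "(h \<circ> r1) \<longlonglongrightarrow> 0" and f1: "(f \<circ> r1) \<longlonglongrightarrow> 0"
    and sol1: "galerkin ((h \<circ> r1) n) ((f \<circ> r1) n) ((\<sigma> \<circ> r1) n) ((u \<circ> r1) n)"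
    and bounds1: "norm ((\<sigma> \<circ> r1) n) \<le> 1" "norm (d (k - 1) ((\<sigma> \<circ> r1) n)) \<le> 1"
      "norm ((u \<circ> r1) n) \<le> 1" "norm (d k ((u \<circ> r1) n)) \<le> 1" for n
    using h sol bounds LIMSEQ_subseq_LIMSEQ[OF h(2) r1(1)] LIMSEQ_subseq_LIMSEQ[OF f r1(1)]
    by simp_all
  obtain r2 :: "nat \<Rightarrow> nat" where r2: "strict_mono r2" "((u \<circ> r1) \<circ> r2) \<longlonglongrightarrow> 0"
    by (rule strongly_null_subsequence[of "h \<circ> r1" "f \<circ> r1" "\<sigma> \<circ> r1" "u \<circ> r1" 1,
      OF h1 sol1 bounds1 f1 r1(2,3)])
  define r where "r n = r1 (r2 n)" for n
  have r: "strict_mono r" using strict_mono_o[OF r1(1) r2(1)] by (simp add: r_def[abs_def] o_def)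
  have u0: "(\<lambda>n. u (r n)) \<longlonglongrightarrow> 0" using r2(2) by (simp add: r_def o_def)
  have hr: "(\<lambda>n. h (r n)) \<longlonglongrightarrow> 0" and fr: "(\<lambda>n. f (r n)) \<longlonglongrightarrow> 0"
    using LIMSEQ_subseq_LIMSEQ[OF h(2) r] LIMSEQ_subseq_LIMSEQ[OF f r] by (simp_all add: o_def)
  note energy = energy_null[of "\<lambda>n. h (r n)" "\<lambda>n. f (r n)" "\<lambda>n. \<sigma> (r n)" "\<lambda>n. u (r n)" 1,
      OF h(1) hr sol bounds fr u0]
  have "(\<lambda>n. norm (\<sigma> (r n)) + norm (d (k - 1) (\<sigma> (r n))) + (norm (u (r n)) + norm (d k (u (r n)))))
      \<longlonglongrightarrow> norm (0::'a) + norm (0::'a) + (norm (0::'a) + norm (0::'a))"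
    by (intro tendsto_add tendsto_norm energy u0)
  then have lim: "(\<lambda>n. norm (\<sigma> (r n)) + norm (d (k - 1) (\<sigma> (r n))) + (norm (u (r n)) + norm (d k (u (r n)))))
      \<longlonglongrightarrow> 0" by simp
  have "1 \<le> norm (\<sigma> (r n)) + norm (d (k - 1) (\<sigma> (r n))) + (norm (u (r n)) + norm (d k (u (r n))))" for n
    using unit[of "r n"] V_norm_le[of d "k - 1" "\<sigma> (r n)"] V_norm_le[of d k "u (r n)"] by linarith
  then have "(1::real) \<le> 0" by (intro LIMSEQ_le_const[OF lim]) blast
  then show False by simp
qed

definition mixed_form :: "'a \<times> 'a \<Rightarrow> 'a \<times> 'a \<Rightarrow> real" where
  "mixed_form x y =
    fst x \<bullet> fst y + snd x \<bullet> (- d (k - 1) (fst y)) + l2 (snd x) \<bullet> (- fst y)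
    + (d (k - 1) (fst x) \<bullet> snd y + l3 (fst x) \<bullet> snd y + d k (snd x) \<bullet> d k (snd y)
      + l1 (snd x) \<bullet> d k (snd y) + l4 (d k (snd x)) \<bullet> snd y + l5 (snd x) \<bullet> snd y)"

lemma linear_mixed_form:
  assumes h: "h > 0"
  shows "linear_map (Vh h (k - 1) \<times> Vh h k) UNIV (\<lambda>x. mixed_form x y)"
    and "linear_map (Vh h (k - 1) \<times> Vh h k) UNIV (\<lambda>y. mixed_form x y)"
proof -
  let ?M = "Vh h (k - 1) \<times> Vh h k"
  have V: "fst x \<in> V (k - 1)" "snd x \<in> V k" if "x \<in> ?M" for x
    using that Vh_in_V[OF h] by auto
  have W: "fst x \<in> W (k - 1)" "snd x \<in> W k" "d k (snd x) \<in> W (k + 1)" if "x \<in> ?M" for x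
    using V[OF that] by (auto intro: in_W d_in_V)
  show "linear_map ?M UNIV (\<lambda>x. mixed_form x y)"
    unfolding linear_map_def
  proof (intro conjI ballI allI UNIV_I)
    fix x x' assume x: "x \<in> ?M" and x': "x' \<in> ?M"
    show "mixed_form (x + x') y = mixed_form x y + mixed_form x' y"
      unfolding mixed_form_def fst_add snd_add d_add[OF V(1)[OF x] V(1)[OF x']]
        d_add[OF V(2)[OF x] V(2)[OF x']]
        linear_map_add[OF l1_linear W(2)[OF x] W(2)[OF x']]
        linear_map_add[OF l2_linear W(2)[OF x] W(2)[OF x']]
        linear_map_add[OF l3_linear W(1)[OF x] W(1)[OF x']]
        linear_map_add[OF l4_linear W(3)[OF x] W(3)[OF x']]
        linear_map_add[OF l5_linear W(2)[OF x] W(2)[OF x']] inner_add_left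
      by simp
  next
    fix c x assume x: "x \<in> ?M"
    show "mixed_form (c *\<^sub>R x) y = c *\<^sub>R mixed_form x y"
      unfolding mixed_form_def fst_scaleR snd_scaleR d_scale[OF V(1)[OF x]] d_scale[OF V(2)[OF x]]
        linear_map_scale[OF l1_linear W(2)[OF x]] linear_map_scale[OF l2_linear W(2)[OF x]]
        linear_map_scale[OF l3_linear W(1)[OF x]] linear_map_scale[OF l4_linear W(3)[OF x]]
        linear_map_scale[OF l5_linear W(2)[OF x]]
      by (simp add: algebra_simps)
  qed
  show "linear_map ?M UNIV (\<lambda>y. mixed_form x y)"
    unfolding linear_map_def
  proof (intro conjI ballI allI UNIV_I)
    fix y y' assume y: "y \<in> ?M" and y': "y' \<in> ?M"
    show "mixed_form x (y + y') = mixed_form x y + mixed_form x y'"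
      unfolding mixed_form_def fst_add snd_add d_add[OF V(1)[OF y] V(1)[OF y']]
        d_add[OF V(2)[OF y] V(2)[OF y']]
      by (simp add: inner_add_right inner_diff_right)
  next
    fix c y assume y: "y \<in> ?M"
    show "mixed_form x (c *\<^sub>R y) = c *\<^sub>R mixed_form x y"
      unfolding mixed_form_def fst_scaleR snd_scaleR d_scale[OF V(1)[OF y]] d_scale[OF V(2)[OF y]]
      by (simp add: algebra_simps)
  qed
qed

lemma galerkin_iff:
  assumes h: "h > 0"
  shows "galerkin h f \<sigma> u \<longleftrightarrow> (\<sigma>, u) \<in> Vh h (k - 1) \<times> Vh h k \<and>
    (\<forall>y\<in>Vh h (k - 1) \<times> Vh h k. mixed_form (\<sigma>, u) y = f \<bullet> snd y)" (is "_ \<longleftrightarrow> ?r")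
proof
  assume s: "galerkin h f \<sigma> u"
  show ?r
  proof (intro conjI ballI)
    show "(\<sigma>, u) \<in> Vh h (k - 1) \<times> Vh h k" using galerkinD(3,4)[OF h s] by blast
    fix y assume "y \<in> Vh h (k - 1) \<times> Vh h k"
    then show "mixed_form (\<sigma>, u) y = f \<bullet> snd y"
      using galerkinD(5)[OF h s, of "fst y"] galerkinD(6)[OF h s, of "snd y"]
      by (auto simp: mixed_form_def)
  qed
next
  assume r: ?r
  have z: "0 \<in> Vh h j" for j by (intro subspace_0 subspace_Vh h)
  have "mixed_form (\<sigma>, u) (\<tau>, 0) = 0" if "\<tau> \<in> Vh h (k - 1)" for \<tau>
    using r z[of k] that by fastforce
  moreover have "mixed_form (\<sigma>, u) (0, v) = f \<bullet> v" if "v \<in> Vh h k" for v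
    using r z[of "k - 1"] that by fastforce
  ultimately show "galerkin h f \<sigma> u"
    using r unfolding mixed_galerkin_solution_def
    by (auto simp: mixed_form_def d_0 inner_add_left add.assoc)
qed

lemma galerkin_combination:
  assumes h: "h > 0" and s: "galerkin h f \<sigma> u" "galerkin h g \<tau> v"
  shows "galerkin h (a *\<^sub>R f + b *\<^sub>R g) (a *\<^sub>R \<sigma> + b *\<^sub>R \<tau>) (a *\<^sub>R u + b *\<^sub>R v)"
proof -
  let ?M = "Vh h (k - 1) \<times> Vh h k"
  have sub: "subspace ?M" by (intro subspace_Times subspace_Vh h)
  have M: "(\<sigma>, u) \<in> ?M" "(\<tau>, v) \<in> ?M" using s galerkin_iff[OF h] by blast+
  have eq: "(a *\<^sub>R \<sigma> + b *\<^sub>R \<tau>, a *\<^sub>R u + b *\<^sub>R v) = a *\<^sub>R (\<sigma>, u) + b *\<^sub>R (\<tau>, v)" by simp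
  note sM = subspace_scale[OF sub M(1), of a] subspace_scale[OF sub M(2), of b]
  note lin = linear_map_add[OF linear_mixed_form(1)[OF h] sM]
    linear_map_scale[OF linear_mixed_form(1)[OF h] M(1)] linear_map_scale[OF linear_mixed_form(1)[OF h] M(2)]
  have f: "\<forall>y\<in>?M. mixed_form (\<sigma>, u) y = f \<bullet> snd y" "\<forall>y\<in>?M. mixed_form (\<tau>, v) y = g \<bullet> snd y"
    using s galerkin_iff[OF h] by blast+
  have "mixed_form (a *\<^sub>R (\<sigma>, u) + b *\<^sub>R (\<tau>, v)) y = (a *\<^sub>R f + b *\<^sub>R g) \<bullet> snd y" if "y \<in> ?M" for y
    using f that by (simp only: lin) (simp add: inner_add_left)
  moreover have "a *\<^sub>R (\<sigma>, u) + b *\<^sub>R (\<tau>, v) \<in> ?M" by (rule subspace_add[OF sub sM])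
  ultimately show ?thesis unfolding galerkin_iff[OF h] eq by blast
qed

lemma stability:
  "\<exists>h0>0. \<exists>C0>0. \<forall>h\<in>{0<..h0}. \<forall>f \<sigma> u. galerkin h f \<sigma> u \<longrightarrow>
    V_norm d (k - 1) \<sigma> + V_norm d k u \<le> C0 * norm f"
proof (rule ccontr)
  assume neg: "\<not> ?thesis"
  have "\<exists>h f \<sigma> u. h \<in> {0<..inverse (real (Suc n))} \<and> galerkin h f \<sigma> u \<and>
      V_norm d (k - 1) \<sigma> + V_norm d k u > real (Suc n) * norm f" for n
  proof (rule ccontr)
    assume "\<not> ?thesis"
    then have "\<forall>h\<in>{0<..inverse (real (Suc n))}. \<forall>f \<sigma> u. galerkin h f \<sigma> u \<longrightarrow>
        V_norm d (k - 1) \<sigma> + V_norm d k u \<le> real (Suc n) * norm f"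
      by (metis not_less)
    moreover have "inverse (real (Suc n)) > 0" "real (Suc n) > 0" by simp_all
    ultimately show False using neg by blast
  qed
  then obtain h f \<sigma> u where h: "\<And>n. h n \<in> {0<..inverse (real (Suc n))}"
    and sol: "\<And>n. galerkin (h n) (f n) (\<sigma> n) (u n)"
    and large: "\<And>n. V_norm d (k - 1) (\<sigma> n) + V_norm d k (u n) > real (Suc n) * norm (f n)"
    by metis
  define N where "N n = V_norm d (k - 1) (\<sigma> n) + V_norm d k (u n)" for n
  have N: "N n > 0" for n
    unfolding N_def by (rule le_less_trans[OF _ large]) simp
  define c where "c n = inverse (N n)" for n
  have c: "c n > 0" "c n * N n = 1" for n using N[of n] by (simp_all add: c_def)
  have hpos: "h n > 0" for n using h[of n] by simp
  have "norm (h n) \<le> inverse (real (Suc n))" for n using h[of n] by simp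
  then have h0: "h \<longlonglongrightarrow> 0"
    by (intro Lim_null_comparison[OF _ LIMSEQ_inverse_real_of_nat] always_eventually allI)
  have sol': "galerkin (h n) (c n *\<^sub>R f n) (c n *\<^sub>R \<sigma> n) (c n *\<^sub>R u n)" for n
    using galerkin_combination[OF hpos sol sol, of n "c n" 0] by simp
  have "norm (c n *\<^sub>R f n) \<le> inverse (real (Suc n))" for n
  proof -
    have "c n * (real (Suc n) * norm (f n)) \<le> c n * N n"
      using large[of n] c(1)[of n] unfolding N_def by (intro mult_left_mono) auto
    then show ?thesis using c(2)[of n] c(1)[of n] by (simp add: field_simps)
  qed
  then have f0: "(\<lambda>n. c n *\<^sub>R f n) \<longlonglongrightarrow> 0"
    by (intro Lim_null_comparison[OF _ LIMSEQ_inverse_real_of_nat] always_eventually allI)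
  have scale: "V_norm d j (a *\<^sub>R v) = a * V_norm d j v" if "v \<in> V j" "a > 0" for a v j
  proof -
    have "V_norm d j (a *\<^sub>R v) = sqrt (a\<^sup>2 * ((norm v)\<^sup>2 + (norm (d j v))\<^sup>2))"
      using that by (simp add: V_norm_def d_scale power_mult_distrib distrib_left)
    then show ?thesis using that by (simp add: V_norm_def real_sqrt_mult)
  qed
  have "V_norm d (k - 1) (c n *\<^sub>R \<sigma> n) + V_norm d k (c n *\<^sub>R u n) = 1" for n
    using c(2)[of n] unfolding N_def
    by (simp add: scale[OF galerkinD(1)[OF hpos sol] c(1)] scale[OF galerkinD(2)[OF hpos sol] c(1)]
        distrib_left)
  with normalized_galerkin_not_null[OF hpos h0 sol' f0] show False by blast
qed

lemma galerkin_well_posed: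
  assumes h: "h > 0"
    and bd: "\<And>f \<sigma> u. galerkin h f \<sigma> u \<Longrightarrow> V_norm d (k - 1) \<sigma> + V_norm d k u \<le> C * norm f"
  shows "\<exists>!(\<sigma>, u). galerkin h f \<sigma> u"
proof -
  let ?M = "Vh h (k - 1) \<times> Vh h k"
  have zero: "\<sigma> = 0 \<and> u = 0" if "galerkin h 0 \<sigma> u" for \<sigma> u
  proof -
    have "V_norm d (k - 1) \<sigma> + V_norm d k u \<le> 0" using bd[OF that] by simp
    then have "norm \<sigma> \<le> 0" "norm u \<le> 0"
      using norm_le_V_norm[of \<sigma> d "k - 1"] norm_le_V_norm[of u d k]
        norm_ge_zero[of \<sigma>] norm_ge_zero[of u] by linarith+
    then show ?thesis by simp
  qed
  obtain A B where A: "finite A" "Vh h (k - 1) = span A" and B: "finite B" "Vh h k = span B"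
    using Vh_finite_span[OF h] by metis
  let ?F = "(\<lambda>a. (a, 0)) ` A \<union> (\<lambda>b. (0, b)) ` B"
  have sub: "subspace ?M" by (intro subspace_Times subspace_Vh h)
  have "?F \<subseteq> ?M"
    unfolding A B by (auto intro: span_base span_zero)
  then have "span ?F \<subseteq> ?M" by (rule span_minimal) (rule sub)
  moreover have "?M \<subseteq> span ?F"
  proof
    fix x assume "x \<in> ?M"
    then obtain a b where x: "x = (a, b)" "a \<in> span A" "b \<in> span B" unfolding A B by blast
    have lin: "linear (\<lambda>a::'a. (a, 0::'a))" "linear (\<lambda>b::'a. (0::'a, b))"
      by (auto intro!: linearI)
    have "(a, 0::'a) \<in> span ((\<lambda>a. (a, 0)) ` A)" "(0::'a, b) \<in> span ((\<lambda>b. (0, b)) ` B)"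
      unfolding linear_span_image[OF lin(1)] linear_span_image[OF lin(2)] using x(2,3) by blast+
    then have "(a, 0) \<in> span ?F" "(0, b) \<in> span ?F"
      using span_mono[of _ ?F] by blast+
    from span_add[OF this] show "x \<in> span ?F" by (simp add: x)
  qed
  ultimately have M: "?M = span ?F" by blast
  have "\<exists>x\<in>?M. \<forall>y\<in>?M. mixed_form x y = f \<bullet> snd y"
  proof (rule solvable_if_unique[OF _ M linear_mixed_form(1)[OF h] linear_mixed_form(2)[OF h]])
    show "finite ?F" using A B by blast
    show "x = 0" if "x \<in> ?M" "\<And>y. y \<in> ?M \<Longrightarrow> mixed_form x y = 0" for x
      using zero[of "fst x" "snd x"] that galerkin_iff[OF h, of 0 "fst x" "snd x"]
      by (simp add: prod_eq_iff)
    show "linear_map ?M UNIV (\<lambda>y. f \<bullet> snd y)"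
      by (simp add: linear_map_def inner_add_right)
  qed
  then obtain x where x: "x \<in> ?M" "\<forall>y\<in>?M. mixed_form x y = f \<bullet> snd y" by blast
  obtain \<sigma> u where "x = (\<sigma>, u)" by (cases x)
  with x have ex: "galerkin h f \<sigma> u" unfolding galerkin_iff[OF h] by blast
  show ?thesis
  proof (rule ex1I[of _ "(\<sigma>, u)"])
    show "case (\<sigma>, u) of (\<sigma>, u) \<Rightarrow> galerkin h f \<sigma> u" using ex by simp
    fix x assume "case x of (\<sigma>, u) \<Rightarrow> galerkin h f \<sigma> u"
    then have "galerkin h f (fst x) (snd x)" by (simp add: case_prod_beta)
    from galerkin_combination[OF h this ex, of 1 "-1"]
    have "galerkin h 0 (fst x - \<sigma>) (snd x - u)" by simp
    from zero[OF this] show "x = (\<sigma>, u)" by (simp add: prod_eq_iff)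
  qed
qed

end

theorem theorem3p2:
  fixes W V :: "int \<Rightarrow> 'a::{real_inner,complete_space} set"
    and d :: "int \<Rightarrow> 'a \<Rightarrow> 'a"
    and k :: int
    and l1 l2 l3 l4 l5 :: "'a \<Rightarrow> 'a"
    and Vh :: "real \<Rightarrow> int \<Rightarrow> 'a set"
    and X :: "'a set"
    and ds l1s l2s l3s L_inv K :: "'a \<Rightarrow> 'a"
    and L L' :: "'a \<Rightarrow> 'a \<Rightarrow> real"
  assumes "hilbert_complex W V d"
    and "compactness_property W V d"
    and "bounded_op (W k) (W (k + 1)) l1"
    and "bounded_op (W k) (W (k - 1)) l2"
    and "bounded_op (W (k - 1)) (W k) l3"
    and "bounded_op (W (k + 1)) (W k) l4"
    and "bounded_op (W k) (W k) l5"
    and X_def: "X = V k \<inter> Vstar W V d k"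
    and ds_def: "ds = dstar W V d k"
    and l1s_def: "l1s = adjoint_op (W k) (W k) l1"
    and l2s_def: "l2s = adjoint_op (W k) (W k) l2"
    and l3s_def: "l3s = adjoint_op (W (k - 1)) (W (k - 1)) l3"
    and L_def: "L = lower_order_operator W V d k l1 l2 l3 l4 l5"
    and L'_def: "L' = dual_operator X L"
    and L_inv_def: "L_inv = (\<lambda>f. inv_into X L (as_functional X f))"
    and K_def: "K = (\<lambda>f. inv_into X L' (as_functional X f))"
    and "bounded_iso_to_dual X (VVstar_norm W V d k) L"
    and "\<forall>f\<in>W k. ds (L_inv f) + l2 (L_inv f) \<in> V (k - 1)"
    and "\<forall>f\<in>W k. ds (K f) + l3s (K f) \<in> V (k - 1)"
    and "\<forall>f\<in>W k. ds (K f) \<in> V (k - 1) \<and> d k (K f) \<in> Vstar W V d (k + 1)"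
    and "bounded_op (W k) (W k) (\<lambda>f. d (k - 1) (ds (K f)) + dstar W V d (k + 1) (d k (K f)))"
    and "\<forall>f\<in>W k. l3s (K f) \<in> V (k - 1)"
    and "compact_op (W k) norm (W k) (\<lambda>f. d (k - 1) (l3s (K f)))"
    and "compact_op (W k) norm (W k) (\<lambda>f. l1s (d k (K f)) - l2s (ds (K f)))"
    and "discrete_subcomplexes V d Vh"
    and "dense_discrete V d Vh"
    and "\<exists>\<pi>. bounded_cochain_projections W V d Vh \<pi>"
  shows "\<exists>h0>0. \<exists>C0>0. \<forall>h\<in>{0<..h0}. \<forall>f\<in>W k.
    (\<exists>!(\<sigma>, u). mixed_galerkin_solution d k l1 l2 l3 l4 l5 (Vh h (k - 1)) (Vh h k) f \<sigma> u) \<and>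
    (\<forall>\<sigma> u. mixed_galerkin_solution d k l1 l2 l3 l4 l5 (Vh h (k - 1)) (Vh h k) f \<sigma> u \<longrightarrow>
       V_norm d (k - 1) \<sigma> + V_norm d k u \<le> C0 * norm f)"
proof -
  obtain \<pi> where \<pi>: "bounded_cochain_projections W V d Vh \<pi>" using assms(27) by blast
  have bij: "bij_betw L X (dual_space X (VVstar_norm W V d k))"
    and lin: "\<And>v. v \<in> X \<Longrightarrow> linear_map X UNIV (\<lambda>u. L u v)"
    using assms(17) unfolding bounded_iso_to_dual_def by blast+
  have "L u \<in> dual_space X (VVstar_norm W V d k)" if "u \<in> X" for u
    using bij that by (rule bij_betwE[THEN bspec])
  then have ext: "L u \<in> extensional X" if "u \<in> X" for u
    using that unfolding dual_space_def by blast
  interpret discrete: discrete_hilbert_complex W V d Vh \<pi>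
    by unfold_locales (fact assms(1) assms(25) assms(26) \<pi>)+
  have X0: "0 \<in> X"
    using discrete.orthogonal_range_Vstar(1)[of 0 k] subspace_0[OF discrete.subspace_V]
      subspace_0[OF discrete.subspace_W] by (simp add: X_def)
  have inj: "u = 0" if u: "u \<in> X" and "\<And>v. v \<in> X \<Longrightarrow> L u v = 0" for u
  proof -
    have "L u = L 0"
    proof (rule extensionalityI[OF ext[OF u] ext[OF X0]])
      fix v assume "v \<in> X"
      then show "L u v = L 0 v" using that(2) linear_map_0[OF lin X0] by simp
    qed
    then show ?thesis using bij u X0 by (auto dest: bij_betw_imp_inj_on inj_onD)
  qed
  interpret mixed_problem W V d Vh \<pi> k l1 l2 l3 l4 l5
    by unfold_locales (fact assms(2-7) | rule inj[unfolded X_def L_def]; assumption)+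
  obtain h0 C0 where "h0 > 0" "C0 > 0" and C0: "\<And>h f \<sigma> u. h \<in> {0<..h0} \<Longrightarrow> galerkin h f \<sigma> u \<Longrightarrow>
      V_norm d (k - 1) \<sigma> + V_norm d k u \<le> C0 * norm f"
    using stability by blast
  have "\<exists>!(\<sigma>, u). galerkin h f \<sigma> u" if "h \<in> {0<..h0}" for h f
    using galerkin_well_posed[of h C0] C0[OF that] that by simp
  then show ?thesis
    by (intro exI[of _ h0] exI[of _ C0] conjI ballI allI impI C0 \<open>h0 > 0\<close> \<open>C0 > 0\<close>)
qed

end
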